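(* Let $(M^{2n+1},\phi,\xi,\eta,g)$ be a compact almost cosymplectic $(\kappa,\mu)$-manifold with $\kappa<0$. Then there does not exist a quasi-Einstein structure $(g,V,m,\lambda)$ on $M$ with $V=\eta(V)\xi$.
   Context: An almost contact metric structure $(\phi,\xi,\eta,g)$ on a smooth manifold $M^{2n+1}$ consists of a $(1,1)$-tensor field $\phi$, a vector field $\xi$ (the Reeb vector field), a 1-form $\eta$ and a Riemannian metric $g$ with $\phi^2=-I+\eta\otimes\xi$, $\eta(\xi)=1$, $\eta\circ\phi=0$, $\phi\xi=0$, $g(\phi X,\phi Y)=g(X,Y)-\eta(X)\eta(Y)$ and $g(X,\xi)=\eta(X)$. The fundamental 2-form is $\omega(X,Y)=g(\phi X,Y)$. $M$ is an almost cosymplectic manifold if $d\eta=0$ and $d\omega=0$. Put $h=\frac12\mathcal{L}_\xi\phi$. An almost cosymplectic $(\kappa,\mu)$-manifold (also called almost $(\kappa,\mu)$-cosymplectic manifold) is an almost cosymplectic manifold with $R(X,Y)\xi=\kappa(\eta(Y)X-\eta(X)Y)+\mu(\eta(Y)hX-\eta(X)hY)$ for all vector fields $X,Y$, where $\kappa,\mu$ are real constants and $R(X,Y)Z=\nabla_X\nabla_YZ-\nabla_Y\nabla_XZ-\nabla_{[X,Y]}Z$. A quasi-Einstein structure $(g,V,m,\lambda)$ on $M$ consists of the metric $g$, a vector field $V$, $m$ an integer with $0<m\le\infty$ ($\frac1m=0$ if $m=\infty$), and a constant $\lambda\in\mathbb{R}$ such that $\mathrm{Ric}+\frac12\mathcal{L}_Vg-\frac1m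 V^\flat\otimes V^\flat=\lambda g$, where $V^\flat$ is the 1-form $g$-dual to $V$. *)

theory Defs
  imports
    "HOL-Analysis.Analysis"
    "HOL-Library.Extended_Nat"
    "HOL-Library.Function_Algebras"
begin

section \<open>Pointwise vector space structure on function spaces\<close>

instantiation "fun" :: (type, real_vector) real_vector
begin

definition scaleR_fun :: "real \<Rightarrow> ('a \<Rightarrow> 'b) \<Rightarrow> 'a \<Rightarrow> 'b"
  where "scaleR_fun c f = (\<lambda>x. c *\<^sub>R f x)"

instance
  by standard
    (auto simp: scaleR_fun_def fun_eq_iff plus_fun_def scaleR_add_right scaleR_add_left)

end

section \<open>Smooth manifolds\<close>

text \<open>Only used for an open set \<open>S\<close>, so that the derivatives are those of \<open>f\<close> on \<open>S\<close>.\<close>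

primrec Ck_on :: "nat \<Rightarrow> 'e::euclidean_space set \<Rightarrow> ('e \<Rightarrow> 'f::real_normed_vector) \<Rightarrow> bool"
  where
    "Ck_on 0 S f \<longleftrightarrow> continuous_on S f"
  | "Ck_on (Suc k) S f \<longleftrightarrow>
       (\<forall>x\<in>S. f differentiable (at x)) \<and>
       (\<forall>v. Ck_on k S (\<lambda>x. frechet_derivative f (at x) v))"

definition smooth_on :: "'e::euclidean_space set \<Rightarrow> ('e \<Rightarrow> 'f::real_normed_vector) \<Rightarrow> bool"
  where "smooth_on S f \<longleftrightarrow> (\<forall>k. Ck_on k S f)"

text \<open>
  The underlying space of the manifold is the whole type \<open>'a\<close>. A chart is a pair \<open>(U, \<psi>)\<close>
  of an open set and a map that is only relevant on \<open>U\<close>. The atlas need not be maximal.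
\<close>

type_synonym ('a, 'e) atlas = "('a set \<times> ('a \<Rightarrow> 'e)) set"

definition smooth_manifold ::
  "('a::{t2_space, second_countable_topology}, 'e::euclidean_space) atlas \<Rightarrow> bool"
  where "smooth_manifold A \<longleftrightarrow>
    (\<forall>(U, \<psi>)\<in>A. open U \<and> open (\<psi> ` U) \<and> homeomorphism U (\<psi> ` U) \<psi> (inv_into U \<psi>)) \<and>
    (\<Union>(U, \<psi>)\<in>A. U) = UNIV \<and>
    (\<forall>(U, \<psi>)\<in>A. \<forall>(W, \<theta>)\<in>A. smooth_on (\<psi> ` (U \<inter> W)) (\<theta> \<circ> inv_into U \<psi>))"

definition smooth_fun ::
  "('a::{t2_space, second_countable_topology}, 'e::euclidean_space) atlas \<Rightarrow> ('a \<Rightarrow> real) \<Rightarrow> bool"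
  where "smooth_fun A f \<longleftrightarrow> (\<forall>(U, \<psi>)\<in>A. smooth_on (\<psi> ` U) (f \<circ> inv_into U \<psi>))"

text \<open>
  Tangent vectors at \<open>p\<close> are the derivations at \<open>p\<close> of the algebra of smooth functions. They are
  normalised to vanish on functions that are not smooth, so that equality of tangent vectors is
  equality in the type.
\<close>

type_synonym 'a tvec = "('a \<Rightarrow> real) \<Rightarrow> real"

definition tangent_space ::
  "('a::{t2_space, second_countable_topology}, 'e::euclidean_space) atlas \<Rightarrow> 'a \<Rightarrow> 'a tvec set"
  where "tangent_space A p = {v.
    (\<forall>f. \<not> smooth_fun A f \<longrightarrow> v f = 0) \<and>
    (\<forall>f g a b. smooth_fun A f \<longrightarrow> smooth_fun A g \<longrightarrow>
       v (\<lambda>q. a * f q + b * g q) = a * v f + b * v g) \<and>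
    (\<forall>f g. smooth_fun A f \<longrightarrow> smooth_fun A g \<longrightarrow>
       v (\<lambda>q. f q * g q) = f p * v g + g p * v f)}"

type_synonym 'a vfield = "'a \<Rightarrow> 'a tvec"

definition deriv_along :: "'a vfield \<Rightarrow> ('a \<Rightarrow> real) \<Rightarrow> 'a \<Rightarrow> real"
  where "deriv_along X f = (\<lambda>p. X p f)"

definition vector_fields ::
  "('a::{t2_space, second_countable_topology}, 'e::euclidean_space) atlas \<Rightarrow> 'a vfield set"
  where "vector_fields A = {X.
    (\<forall>p. X p \<in> tangent_space A p) \<and>
    (\<forall>f. smooth_fun A f \<longrightarrow> smooth_fun A (deriv_along X f))}"

definition fmult :: "('a \<Rightarrow> real) \<Rightarrow> 'a vfield \<Rightarrow> 'a vfield"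
  where "fmult u X = (\<lambda>p. u p *\<^sub>R X p)"

text \<open>
  On a non-smooth \<open>f\<close> both terms are derivatives of the zero function, so the bracket of two
  vector fields is normalised in the same way as they are.
\<close>

definition lie_bracket :: "'a vfield \<Rightarrow> 'a vfield \<Rightarrow> 'a vfield"
  where "lie_bracket X Y =
    (\<lambda>p f. X p (deriv_along Y f) - Y p (deriv_along X f))"

section \<open>Tensor fields\<close>

text \<open>
  A tensor field is a family of (multi)linear maps on the tangent spaces that is smooth in the
  sense that it sends smooth vector fields to smooth functions or smooth vector fields.
\<close>

definition lin_on :: "'v::real_vector set \<Rightarrow> ('v \<Rightarrow> 'w::real_vector) \<Rightarrow> bool"
  where "lin_on T F \<longleftrightarrow>
    (\<forall>v\<in>T. \<forall>w\<in>T. \<forall>a b. F (a *\<^sub>R v + b *\<^sub>R w) = a *\<^sub>R F v + b *\<^sub>R F w)"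

type_synonym 'a form1 = "'a \<Rightarrow> 'a tvec \<Rightarrow> real"
type_synonym 'a bilin = "'a \<Rightarrow> 'a tvec \<Rightarrow> 'a tvec \<Rightarrow> real"
type_synonym 'a tensor11 = "'a \<Rightarrow> 'a tvec \<Rightarrow> 'a tvec"

definition app1 :: "'a form1 \<Rightarrow> 'a vfield \<Rightarrow> 'a \<Rightarrow> real"
  where "app1 \<alpha> X = (\<lambda>p. \<alpha> p (X p))"

definition app2 :: "'a bilin \<Rightarrow> 'a vfield \<Rightarrow> 'a vfield \<Rightarrow> 'a \<Rightarrow> real"
  where "app2 b X Y = (\<lambda>p. b p (X p) (Y p))"

definition app11 :: "'a tensor11 \<Rightarrow> 'a vfield \<Rightarrow> 'a vfield"
  where "app11 \<phi> X = (\<lambda>p. \<phi> p (X p))"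

definition one_form ::
  "('a::{t2_space, second_countable_topology}, 'e::euclidean_space) atlas \<Rightarrow> 'a form1 \<Rightarrow> bool"
  where "one_form A \<alpha> \<longleftrightarrow>
    (\<forall>p. lin_on (tangent_space A p) (\<alpha> p)) \<and>
    (\<forall>X\<in>vector_fields A. smooth_fun A (app1 \<alpha> X))"

definition tensor_field11 ::
  "('a::{t2_space, second_countable_topology}, 'e::euclidean_space) atlas \<Rightarrow> 'a tensor11 \<Rightarrow> bool"
  where "tensor_field11 A \<phi> \<longleftrightarrow>
    (\<forall>p. lin_on (tangent_space A p) (\<phi> p) \<and> \<phi> p ` tangent_space A p \<subseteq> tangent_space A p) \<and>
    (\<forall>X\<in>vector_fields A. app11 \<phi> X \<in> vector_fields A)"

definition riemannian_metric ::
  "('a::{t2_space, second_countable_topology}, 'e::euclidean_space) atlas \<Rightarrow> 'a bilin \<Rightarrow> bool"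
  where "riemannian_metric A g \<longleftrightarrow>
    (\<forall>p. \<forall>v\<in>tangent_space A p.
       lin_on (tangent_space A p) (g p v) \<and>
       (\<forall>w\<in>tangent_space A p. g p v w = g p w v) \<and>
       (v \<noteq> 0 \<longrightarrow> g p v v > 0)) \<and>
    (\<forall>X\<in>vector_fields A. \<forall>Y\<in>vector_fields A. smooth_fun A (app2 g X Y))"

definition closed1 ::
  "('a::{t2_space, second_countable_topology}, 'e::euclidean_space) atlas \<Rightarrow> 'a form1 \<Rightarrow> bool"
  where "closed1 A \<alpha> \<longleftrightarrow>
    (\<forall>X\<in>vector_fields A. \<forall>Y\<in>vector_fields A.
       deriv_along X (app1 \<alpha> Y) - deriv_along Y (app1 \<alpha> X) - app1 \<alpha> (lie_bracket X Y) = 0)"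

definition closed2 ::
  "('a::{t2_space, second_countable_topology}, 'e::euclidean_space) atlas \<Rightarrow> 'a bilin \<Rightarrow> bool"
  where "closed2 A \<omega> \<longleftrightarrow>
    (\<forall>X\<in>vector_fields A. \<forall>Y\<in>vector_fields A. \<forall>Z\<in>vector_fields A.
       deriv_along X (app2 \<omega> Y Z) + deriv_along Y (app2 \<omega> Z X) + deriv_along Z (app2 \<omega> X Y)
       - app2 \<omega> (lie_bracket X Y) Z - app2 \<omega> (lie_bracket Y Z) X - app2 \<omega> (lie_bracket Z X) Y
       = 0)"

definition lie_deriv11 :: "'a vfield \<Rightarrow> 'a tensor11 \<Rightarrow> 'a vfield \<Rightarrow> 'a vfield"
  where "lie_deriv11 V \<phi> X = lie_bracket V (app11 \<phi> X) - app11 \<phi> (lie_bracket V X)"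

definition lie_deriv2 :: "'a vfield \<Rightarrow> 'a bilin \<Rightarrow> 'a vfield \<Rightarrow> 'a vfield \<Rightarrow> 'a \<Rightarrow> real"
  where "lie_deriv2 V g X Y =
    deriv_along V (app2 g X Y) - app2 g (lie_bracket V X) Y - app2 g X (lie_bracket V Y)"

section \<open>Levi-Civita connection and curvature\<close>

type_synonym 'a connection = "'a vfield \<Rightarrow> 'a vfield \<Rightarrow> 'a vfield"

text \<open>
  By the fundamental theorem of Riemannian geometry, for a metric \<open>g\<close> there is a \<open>D\<close> with this
  property, unique on vector fields; \<open>D X Y\<close> is the covariant derivative of \<open>Y\<close> along \<open>X\<close>.
\<close>

definition levi_civita ::
  "('a::{t2_space, second_countable_topology}, 'e::euclidean_space) atlas \<Rightarrow>
    'a bilin \<Rightarrow> 'a connection \<Rightarrow> bool"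
  where "levi_civita A g D \<longleftrightarrow>
    (\<forall>X\<in>vector_fields A. \<forall>Y\<in>vector_fields A.
       D X Y \<in> vector_fields A \<and>
       (\<forall>Z\<in>vector_fields A. D (X + Y) Z = D X Z + D Y Z \<and> D X (Y + Z) = D X Y + D X Z) \<and>
       (\<forall>u. smooth_fun A u \<longrightarrow>
          D (fmult u X) Y = fmult u (D X Y) \<and>
          D X (fmult u Y) = fmult (deriv_along X u) Y + fmult u (D X Y)) \<and>
       D X Y - D Y X = lie_bracket X Y \<and>
       (\<forall>Z\<in>vector_fields A.
          deriv_along X (app2 g Y Z) = app2 g (D X Y) Z + app2 g Y (D X Z)))"

definition curvature :: "'a connection \<Rightarrow> 'a vfield \<Rightarrow> 'a vfield \<Rightarrow> 'a vfield \<Rightarrow> 'a vfield"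
  where "curvature D X Y Z = D X (D Y Z) - D Y (D X Z) - D (lie_bracket X Y) Z"

text \<open>
  Vector fields \<open>E 0, E 1, \<dots>\<close>, as many as the dimension of the manifold, whose values at \<open>p\<close> form
  an orthonormal basis of the tangent space at \<open>p\<close>.
\<close>

definition orthonormal_at ::
  "('a::{t2_space, second_countable_topology}, 'e::euclidean_space) atlas \<Rightarrow>
    'a bilin \<Rightarrow> 'a \<Rightarrow> (nat \<Rightarrow> 'a vfield) \<Rightarrow> bool"
  where "orthonormal_at A g p E \<longleftrightarrow>
    (\<forall>i<DIM('e). E i \<in> vector_fields A) \<and>
    (\<forall>i<DIM('e). \<forall>j<DIM('e). g p (E i p) (E j p) = (if i = j then 1 else 0))"

text \<open>
  \<open>Ric(Y, Z)\<close> at \<open>p\<close> is the trace of \<open>v \<mapsto> R(v, Y)Z\<close> on the tangent space at \<open>p\<close>; the choice of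
  the orthonormal basis (and of its extension to vector fields) is immaterial.
\<close>

definition ricci ::
  "('a::{t2_space, second_countable_topology}, 'e::euclidean_space) atlas \<Rightarrow>
    'a bilin \<Rightarrow> 'a connection \<Rightarrow> 'a vfield \<Rightarrow> 'a vfield \<Rightarrow> 'a \<Rightarrow> real"
  where "ricci A g D Y Z = (\<lambda>p.
    let E = (SOME E. orthonormal_at A g p E)
    in \<Sum>i<DIM('e). g p (curvature D (E i) Y Z p) (E i p))"

section \<open>Almost cosymplectic manifolds\<close>

definition almost_contact_metric ::
  "('a::{t2_space, second_countable_topology}, 'e::euclidean_space) atlas \<Rightarrow>
    'a tensor11 \<Rightarrow> 'a vfield \<Rightarrow> 'a form1 \<Rightarrow> 'a bilin \<Rightarrow> bool"
  where "almost_contact_metric A \<phi> \<xi> \<eta> g \<longleftrightarrow>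
    tensor_field11 A \<phi> \<and> \<xi> \<in> vector_fields A \<and> one_form A \<eta> \<and> riemannian_metric A g \<and>
    (\<forall>p. \<eta> p (\<xi> p) = 1 \<and> \<phi> p (\<xi> p) = 0 \<and>
      (\<forall>v\<in>tangent_space A p.
         \<phi> p (\<phi> p v) = - v + \<eta> p v *\<^sub>R \<xi> p \<and>
         \<eta> p (\<phi> p v) = 0 \<and>
         g p v (\<xi> p) = \<eta> p v \<and>
         (\<forall>w\<in>tangent_space A p. g p (\<phi> p v) (\<phi> p w) = g p v w - \<eta> p v * \<eta> p w)))"

definition fundamental_form :: "'a tensor11 \<Rightarrow> 'a bilin \<Rightarrow> 'a bilin"
  where "fundamental_form \<phi> g = (\<lambda>p v w. g p (\<phi> p v) w)"

definition almost_cosymplectic ::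
  "('a::{t2_space, second_countable_topology}, 'e::euclidean_space) atlas \<Rightarrow>
    'a tensor11 \<Rightarrow> 'a vfield \<Rightarrow> 'a form1 \<Rightarrow> 'a bilin \<Rightarrow> bool"
  where "almost_cosymplectic A \<phi> \<xi> \<eta> g \<longleftrightarrow>
    almost_contact_metric A \<phi> \<xi> \<eta> g \<and> closed1 A \<eta> \<and> closed2 A (fundamental_form \<phi> g)"

definition h_tensor :: "'a tensor11 \<Rightarrow> 'a vfield \<Rightarrow> 'a vfield \<Rightarrow> 'a vfield"
  where "h_tensor \<phi> \<xi> X = (1/2) *\<^sub>R lie_deriv11 \<xi> \<phi> X"

definition almost_cosymplectic_kappa_mu ::
  "('a::{t2_space, second_countable_topology}, 'e::euclidean_space) atlas \<Rightarrow>
    'a tensor11 \<Rightarrow> 'a vfield \<Rightarrow> 'a form1 \<Rightarrow> 'a bilin \<Rightarrow> 'a connection \<Rightarrow> real \<Rightarrow> real \<Rightarrow> bool"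
  where "almost_cosymplectic_kappa_mu A \<phi> \<xi> \<eta> g D \<kappa> \<mu> \<longleftrightarrow>
    almost_cosymplectic A \<phi> \<xi> \<eta> g \<and> levi_civita A g D \<and>
    (\<forall>X\<in>vector_fields A. \<forall>Y\<in>vector_fields A.
       curvature D X Y \<xi> =
         \<kappa> *\<^sub>R (fmult (app1 \<eta> Y) X - fmult (app1 \<eta> X) Y)
         + \<mu> *\<^sub>R (fmult (app1 \<eta> Y) (h_tensor \<phi> \<xi> X) - fmult (app1 \<eta> X) (h_tensor \<phi> \<xi> Y)))"

section \<open>Quasi-Einstein structures\<close>

definition recip :: "enat \<Rightarrow> real"
  where "recip m = (case m of enat k \<Rightarrow> 1 / real k | \<infinity> \<Rightarrow> 0)"

definition flat :: "'a bilin \<Rightarrow> 'a vfield \<Rightarrow> 'a form1"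
  where "flat g V = (\<lambda>p v. g p (V p) v)"

definition quasi_einstein ::
  "('a::{t2_space, second_countable_topology}, 'e::euclidean_space) atlas \<Rightarrow>
    'a bilin \<Rightarrow> 'a connection \<Rightarrow> 'a vfield \<Rightarrow> enat \<Rightarrow> real \<Rightarrow> bool"
  where "quasi_einstein A g D V m lam \<longleftrightarrow>
    V \<in> vector_fields A \<and> 0 < m \<and>
    (\<forall>X\<in>vector_fields A. \<forall>Y\<in>vector_fields A.
       ricci A g D X Y + (1/2) *\<^sub>R lie_deriv2 V g X Y
         - recip m *\<^sub>R (\<lambda>p. app1 (flat g V) X p * app1 (flat g V) Y p)
       = lam *\<^sub>R app2 g X Y)"

end

theory Submission
  imports Defs
begin

text \<open>
  Let \<open>S X = \<nabla>\<^sub>X \<xi>\<close>. Closedness of \<open>\<eta>\<close> and \<open>\<omega>\<close> makes \<open>S\<close> symmetric and anticommuting with \<open>\<phi>\<close>,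
  with \<open>h = \<phi> S\<close>, and the \<open>(\<kappa>, \<mu>)\<close>-condition gives \<open>S\<^sup>2 = - \<kappa>\<close> on \<open>ker \<eta>\<close>. There \<open>S\<close> is a Codazzi
  tensor whose only eigenvalues are the constants \<open>\<plusminus> sqrt (- \<kappa>)\<close>, hence it is parallel along the leaves
  of \<open>ker \<eta>\<close>; comparing eigenspaces, so is \<open>\<phi>\<close>, and a leaf whose Levi-Civita connection preserves both is
  flat. The Gauss equation then yields \<open>Ric = \<mu> g(h \<cdot>, \<cdot>)\<close> on \<open>ker \<eta>\<close>.

  If \<open>V = f \<xi>\<close> is quasi-Einstein, then on \<open>ker \<eta>\<close> the equation reads \<open>\<mu> \<phi> S + f S = \<lambda>\<close>. The left side
  anticommutes with \<open>\<phi>\<close>, so \<open>\<lambda> = 0\<close>, and \<open>S X\<close>, \<open>\<phi> S X\<close> are orthogonal and non-zero, so \<open>f = 0\<close> and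
  \<open>\<mu> = 0\<close>. Now \<open>Ric(\<xi>, \<xi>) = 0\<close>, whereas the \<open>(\<kappa>, \<mu>)\<close>-condition gives \<open>Ric(\<xi>, \<xi>) = 2 n \<kappa> < 0\<close>.

  Since \<open>ricci\<close> is a sum over a chosen orthonormal basis of vector fields, the existence of such a
  basis is needed as well; it rests on Hadamard's lemma, which shows that the space of derivations at
  a point has the dimension of the manifold.
\<close>

section \<open>Calculus\<close>

lemma Ck_on_cong:
  assumes "open S" "\<And>x. x \<in> S \<Longrightarrow> f x = g x" "Ck_on k S f"
  shows "Ck_on k S g"
  using assms(2,3)
proof (induction k arbitrary: f g)
  case 0
  then show ?case by (metis Ck_on.simps(1) continuous_on_cong)
next
  case (Suc k)
  have d: "(g has_derivative frechet_derivative f (at x)) (at x)" if "x \<in> S" for x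
    using has_derivative_transform_within_open[OF _ assms(1) that] Suc.prems that
    by (metis Ck_on.simps(2) frechet_derivative_works)
  then have e: "frechet_derivative f (at x) = frechet_derivative g (at x)" if "x \<in> S" for x
    using frechet_derivative_at that by blast
  have "Ck_on k S (\<lambda>x. frechet_derivative g (at x) v)" for v
    by (rule Suc.IH[of "\<lambda>x. frechet_derivative f (at x) v"]) (use Suc.prems e in auto)
  then show ?case using d by (auto simp: differentiable_def)
qed

text \<open>\<open>Ck_on\<close> speaks of the derivative picked by
  \<open>frechet_derivative\<close>; uniqueness of derivatives lets any explicit formula take its
  place. Most closure proofs below enter the successor case through this rule.\<close>

lemma Ck_on_SucI:
  assumes "open S" "\<And>x. x \<in> S \<Longrightarrow> (f has_derivative f' x) (at x)"
    "\<And>v. Ck_on k S (\<lambda>x. f' x v)"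
  shows "Ck_on (Suc k) S f"
proof -
  have "f' x = frechet_derivative f (at x)" if "x \<in> S" for x
    using frechet_derivative_at assms(2) that by blast
  then have "Ck_on k S (\<lambda>x. frechet_derivative f (at x) v)" for v
    by (intro Ck_on_cong[OF assms(1) _ assms(3)]) auto
  then show ?thesis using assms(2) by (auto simp: differentiable_def)
qed

lemma Ck_on_SucD: "Ck_on (Suc k) S f \<Longrightarrow> Ck_on k S f"
proof (induction k arbitrary: f)
  case 0
  then show ?case
    by (simp add: continuous_at_imp_continuous_on differentiable_imp_continuous_within)
next
  case (Suc k)
  then show ?case by (metis Ck_on.simps(2))
qed

lemma Ck_on_has_derivative:
  "Ck_on (Suc k) S f \<Longrightarrow> x \<in> S \<Longrightarrow> (f has_derivative frechet_derivative f (at x)) (at x)"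
  by (simp add: frechet_derivative_works)

lemma Ck_on_subset: "Ck_on k S f \<Longrightarrow> T \<subseteq> S \<Longrightarrow> Ck_on k T f"
  by (induction k arbitrary: f) (auto intro: continuous_on_subset)

text \<open>Being C^k is a local property. This glues the two descriptions of a function cut off
  inside a chart, near the support and away from it.\<close>

lemma Ck_on_local:
  assumes "\<And>x. x \<in> S \<Longrightarrow> \<exists>T. open T \<and> x \<in> T \<and> Ck_on k T f"
  shows "Ck_on k S f"
  using assms
proof (induction k arbitrary: f)
  case 0
  then show ?case
    by (metis Ck_on.simps(1) continuous_at_imp_continuous_on continuous_on_eq_continuous_at)
next
  case (Suc k)
  then show ?case by (simp, metis)
qed

lemma Ck_on_const: "open S \<Longrightarrow> Ck_on k S (\<lambda>x. c)"
  by (induction k arbitrary: c) (auto simp del: Ck_on.simps(2) intro!: Ck_on_SucI derivative_eq_intros)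

lemma Ck_on_add:
  "open S \<Longrightarrow> Ck_on k S f \<Longrightarrow> Ck_on k S g \<Longrightarrow> Ck_on k S (\<lambda>x. f x + g x)"
proof (induction k arbitrary: f g)
  case (Suc k)
  show ?case
    by (rule Ck_on_SucI[OF Suc.prems(1) has_derivative_add
          [OF Ck_on_has_derivative[OF Suc.prems(2)] Ck_on_has_derivative[OF Suc.prems(3)]]])
      (use Suc in auto)
qed (auto intro: continuous_intros)

lemma Ck_on_linear_comp:
  "open S \<Longrightarrow> bounded_linear L \<Longrightarrow> Ck_on k S f \<Longrightarrow> Ck_on k S (\<lambda>x. L (f x))"
proof (induction k arbitrary: f)
  case 0
  then show ?case by (auto intro: bounded_linear.continuous_on)
next
  case (Suc k)
  show ?case
    by (rule Ck_on_SucI[OF Suc.prems(1) bounded_linear.has_derivative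
          [OF Suc.prems(2) Ck_on_has_derivative[OF Suc.prems(3)]]])
      (use Suc in auto)
qed

lemma Ck_on_linear: "open S \<Longrightarrow> bounded_linear L \<Longrightarrow> Ck_on k S L"
  by (cases k) (auto simp del: Ck_on.simps(2) simp: linear_continuous_on intro!: Ck_on_SucI Ck_on_const bounded_linear_imp_has_derivative)

lemma Ck_on_mult:
  fixes f g :: "_ \<Rightarrow> real"
  shows "open S \<Longrightarrow> Ck_on k S f \<Longrightarrow> Ck_on k S g \<Longrightarrow> Ck_on k S (\<lambda>x. f x * g x)"
proof (induction k arbitrary: f g)
  case (Suc k)
  have "Ck_on k S f" "Ck_on k S g"
    using Suc.prems Ck_on_SucD by blast+
  then show ?case
    by (intro Ck_on_SucI[OF Suc.prems(1) has_derivative_mult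
          [OF Ck_on_has_derivative[OF Suc.prems(2)] Ck_on_has_derivative[OF Suc.prems(3)]]])
      (use Suc in \<open>auto intro!: Ck_on_add\<close>)
qed (auto intro: continuous_intros)

lemma Ck_on_sum:
  "open S \<Longrightarrow> (\<And>i. i \<in> I \<Longrightarrow> Ck_on k S (f i)) \<Longrightarrow> Ck_on k S (\<lambda>x. \<Sum>i\<in>I. f i x)"
  by (induction I rule: infinite_finite_induct) (auto intro: Ck_on_const Ck_on_add)

lemma Ck_on_compose:
  fixes f :: "'f::euclidean_space \<Rightarrow> real"
  assumes "open S" "g ` S \<subseteq> T"
  shows "Ck_on k T f \<Longrightarrow> Ck_on k S g \<Longrightarrow> Ck_on k S (\<lambda>x. f (g x))"
proof (induction k arbitrary: f)
  case 0
  then show ?case using assms by (auto intro: continuous_on_compose2)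
next
  case (Suc k)
  let ?f' = "\<lambda>y. frechet_derivative f (at y)" and ?g' = "\<lambda>y. frechet_derivative g (at y)"
  have df: "(f has_derivative ?f' (g x)) (at (g x))" if "x \<in> S" for x
    using Suc.prems(1) assms(2) that by (auto intro!: Ck_on_has_derivative simp del: Ck_on.simps(2))
  have dg: "(g has_derivative ?g' x) (at x)" if "x \<in> S" for x
    using Suc.prems(2) that Ck_on_has_derivative by blast
  \<comment> \<open>The composite of two derivatives that both depend on \<open>x\<close> is
    expanded in a basis. It becomes a sum of products of real functions, to which the induction
    hypothesis and the product rule apply.\<close>
  have "((\<lambda>x. f (g x)) has_derivative (\<lambda>v. \<Sum>b\<in>Basis. (?g' x v \<bullet> b) * ?f' (g x) b)) (at x)"
    if "x \<in> S" for x
  proof -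
    have "bounded_linear (?f' (g x))" using df that by blast
    then have "linear (?f' (g x))" by (rule bounded_linear.linear)
    then have "(\<lambda>v. ?f' (g x) (?g' x v)) = (\<lambda>v. \<Sum>b\<in>Basis. (?g' x v \<bullet> b) * ?f' (g x) b)"
      by (subst euclidean_representation[symmetric])
         (simp add: linear_sum linear_cmul del: euclidean_representation)
    then show ?thesis using has_derivative_compose[OF dg df, OF that that] by simp
  qed
  moreover have "Ck_on k S g"
    using Suc.prems Ck_on_SucD by blast
  moreover have "Ck_on k S (\<lambda>x. ?f' (g x) b)" for b
    by (rule Suc.IH[of "\<lambda>y. ?f' y b"]) (use Suc.prems calculation in auto)
  ultimately show ?case
    by (intro Ck_on_SucI[OF assms(1)])
       (use Suc assms(1) in \<open>auto intro!: Ck_on_sum Ck_on_mult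
          Ck_on_linear_comp[OF _ bounded_linear_inner_left]\<close>)
qed

section \<open>The flat function exp(-1/t)\<close>

text \<open>The power of 1/t makes the family closed under differentiation: each derivative is a
  combination of the members with indices n + 1 and n + 2.\<close>

definition flat_fun :: "nat \<Rightarrow> real \<Rightarrow> real"
  where "flat_fun n t = (if t > 0 then inverse t ^ n * exp (- inverse t) else 0)"

text \<open>From the right, with s = 1/t tending to infinity, this is the limit of s^n / exp
  s.\<close>

lemma flat_fun_tendsto_0: "(flat_fun n \<longlongrightarrow> 0) (at 0)"
proof -
  have "(flat_fun n \<longlongrightarrow> 0) (at_left 0)"
    by (rule Lim_transform_eventually[OF tendsto_const])
       (auto simp: flat_fun_def eventually_at_filter)
  moreover have "((\<lambda>t::real. inverse t ^ n / exp (inverse t)) \<longlongrightarrow> 0) (at_right 0)"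
    using filterlim_compose[OF tendsto_power_div_exp_0 filterlim_inverse_at_top_right] .
  then have "(flat_fun n \<longlongrightarrow> 0) (at_right 0)"
    by (rule Lim_transform_eventually) (auto simp: flat_fun_def eventually_at_filter exp_minus divide_inverse)
  ultimately show ?thesis
    by (simp add: filterlim_split_at)
qed

lemma flat_fun_has_derivative:
  "(flat_fun n has_derivative (\<lambda>v. (flat_fun (n + 2) t - n * flat_fun (n + 1) t) * v)) (at t)"
proof -
  have "(flat_fun n has_real_derivative (flat_fun (n + 2) t - n * flat_fun (n + 1) t)) (at t)"
  proof (cases t "0::real" rule: linorder_cases)
    case less
    have "((\<lambda>_. 0) has_real_derivative 0) (at t)" by simp
    then have "(flat_fun n has_real_derivative 0) (at t)"
      by (rule has_field_derivative_transform_within_open[where S="{..<0}"]) (use less in \<open>auto simp: flat_fun_def\<close>)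
    then show ?thesis using less by (simp add: flat_fun_def)
  next
    case greater
    have i: "((\<lambda>t. inverse t) has_real_derivative - (inverse t * inverse t)) (at t)"
      using DERIV_inverse[of t] greater by (simp add: power2_eq_square)
    have "((\<lambda>t. inverse t ^ n * exp (- inverse t)) has_real_derivative
        inverse t ^ n * (exp (- inverse t) * (inverse t * inverse t))
        + (real n * (inverse t ^ (n - 1) * - (inverse t * inverse t))) * exp (- inverse t)) (at t)"
      by (rule derivative_eq_intros i refl | simp)+
    also have "inverse t ^ n * (exp (- inverse t) * (inverse t * inverse t))
        + (real n * (inverse t ^ (n - 1) * - (inverse t * inverse t))) * exp (- inverse t)
        = flat_fun (n + 2) t - n * flat_fun (n + 1) t"
      \<comment> \<open>The split on \<open>n\<close> covers the truncated exponent
        \<open>n - 1\<close> at \<open>n = 0\<close>, where its coefficient is 0.\<close>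
      using greater by (cases n) (simp_all add: flat_fun_def)
    finally show ?thesis
      by (rule has_field_derivative_transform_within_open[where S="{0<..}"]) (use greater in \<open>auto simp: flat_fun_def\<close>)
  next
    case equal
    \<comment> \<open>Dividing by t raises the index by one, so the difference quotient at 0 is
      again a member of the family.\<close>
    have "((\<lambda>t. flat_fun n t / t) \<longlongrightarrow> 0) (at 0)"
      by (rule Lim_transform_eventually[OF flat_fun_tendsto_0[of "Suc n"]])
         (auto simp: flat_fun_def divide_inverse)
    then show ?thesis using equal by (simp add: DERIV_def flat_fun_def)
  qed
  then show ?thesis by (simp add: has_field_derivative_def)
qed

lemma Ck_on_flat_fun: "Ck_on k UNIV (flat_fun n)"
proof (induction k arbitrary: n)
  case 0
  then show ?case
    using flat_fun_has_derivative by (auto intro!: continuous_at_imp_continuous_on has_derivative_continuous)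
next
  case (Suc k)
  have *: "Ck_on k UNIV (\<lambda>t. flat_fun m t * c)" for c m
    by (intro Ck_on_mult Ck_on_const Suc.IH open_UNIV)
  have "Ck_on k UNIV (\<lambda>t. (flat_fun (n + 2) t - n * flat_fun (n + 1) t) * v)" for v
  proof (rule Ck_on_cong[OF open_UNIV _ Ck_on_add[OF open_UNIV *[of "n + 2" v] *[of "n + 1" "- n * v"]]])
  qed (simp add: algebra_simps)
  then show ?case
    by (intro Ck_on_SucI[OF open_UNIV flat_fun_has_derivative])
qed

section \<open>Integrals with a parameter and Hadamard's lemma\<close>

text \<open>Each differentiation in \<open>x\<close> brings out a factor \<open>t\<close> from the
  inner map, so the statement carries \<open>t ^ j\<close> in order to pass through the induction.
  Convexity keeps the segment from \<open>c\<close> to \<open>x\<close> inside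
  \<open>S\<close>.\<close>

lemma Ck_on_parametric_integral:
  fixes F :: "'e::euclidean_space \<Rightarrow> real"
  assumes "open S" "convex S" "c \<in> S"
  shows "Ck_on k S F \<Longrightarrow> Ck_on k S (\<lambda>x. integral {0..1} (\<lambda>t. t ^ j * F (c + t *\<^sub>R (x - c))))"
proof (induction k arbitrary: F j)
  case 0
  have m: "c + t *\<^sub>R (x - c) \<in> S" if "x \<in> S" "t \<in> {0..1}" for x t
    using convexD[OF assms(2,3) that(1), of "1 - t" t] that by (simp add: algebra_simps)
  have "continuous_on (S \<times> {0..1}) (\<lambda>(x, t). t ^ j * F (c + t *\<^sub>R (x - c)))"
    unfolding case_prod_beta
    by (intro continuous_intros continuous_on_compose2[OF 0[simplified]]) (use m in auto)
  then show ?case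
    using integral_continuous_on_param[of S 0 1 "\<lambda>x t. t ^ j * F (c + t *\<^sub>R (x - c))"] by simp
next
  case (Suc k)
  have m: "c + t *\<^sub>R (x - c) \<in> S" if "x \<in> S" "t \<in> {0..1}" for x t
    using convexD[OF assms(2,3) that(1), of "1 - t" t] that by (simp add: algebra_simps)
  let ?F' = "\<lambda>y. frechet_derivative F (at y)"
  \<comment> \<open>The Leibniz rule takes the derivative as a bounded linear map depending
    continuously on both variables; continuity is checked on basis vectors.\<close>
  let ?fx = "\<lambda>x t. (t ^ Suc j) *\<^sub>R Blinfun (?F' (c + t *\<^sub>R (x - c)))"
  have dF: "(F has_derivative ?F' y) (at y)" if "y \<in> S" for y
    using Suc.prems that by (rule Ck_on_has_derivative)
  have B: "blinfun_apply (Blinfun (?F' y)) = ?F' y" if "y \<in> S" for y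
    using dF[OF that] has_derivative_bounded_linear bounded_linear_Blinfun_apply by blast
  have cF: "continuous_on S F"
    using Suc.prems dF by (auto intro!: continuous_at_imp_continuous_on has_derivative_continuous)
  have cF': "continuous_on S (\<lambda>y. Blinfun (?F' y))"
  proof (rule continuous_on_blinfun_componentwise)
    fix i :: 'e
    have "Ck_on k S (\<lambda>y. ?F' y i)" using Suc.prems by simp
    then have "continuous_on S (\<lambda>y. ?F' y i)"
      by (cases k) (auto intro!: continuous_at_imp_continuous_on differentiable_imp_continuous_within)
    then show "continuous_on S (\<lambda>y. blinfun_apply (Blinfun (?F' y)) i)"
      by (rule continuous_on_eq) (simp add: B)
  qed
  have cont: "continuous_on (S \<times> {0..1}) (\<lambda>(x, t). ?fx x t)"
    unfolding case_prod_beta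
    by (intro continuous_intros continuous_on_compose2[OF cF']) (use m in auto)
  have cx: "continuous_on {0..1} (?fx x)" if "x \<in> S" for x
    by (intro continuous_intros continuous_on_compose2[OF cF']) (use m that in auto)
  have L: "((\<lambda>x. integral (cbox 0 1) (\<lambda>t. t ^ j * F (c + t *\<^sub>R (x - c)))) has_derivative
      blinfun_apply (integral (cbox 0 1) (?fx x))) (at x within S)" if "x \<in> S" for x
  proof (rule leibniz_rule[OF _ _ _ that assms(2)])
    fix x t assume x: "x \<in> S" and t: "t \<in> cbox 0 (1::real)"
    let ?y = "c + t *\<^sub>R (x - c)"
    have y: "?y \<in> S" using m x t by simp
    have lin: "linear (?F' ?y)"
      using dF[OF y] has_derivative_linear by blast
    have g: "((\<lambda>x. c + t *\<^sub>R (x - c)) has_derivative (\<lambda>v. t *\<^sub>R v)) (at x)"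
      by (auto intro!: derivative_eq_intros)
    have "((\<lambda>x. F (c + t *\<^sub>R (x - c))) has_derivative (\<lambda>v. ?F' ?y (t *\<^sub>R v))) (at x)"
      using has_derivative_compose[OF g dF[OF y]] .
    then have "((\<lambda>x. t ^ j * F (c + t *\<^sub>R (x - c))) has_derivative (\<lambda>v. t ^ j * ?F' ?y (t *\<^sub>R v))) (at x)"
      by (rule has_derivative_mult_right)
    moreover have "(\<lambda>v. t ^ j * ?F' ?y (t *\<^sub>R v)) = blinfun_apply (?fx x t)"
      using B[OF y] linear_cmul[OF lin] by (auto simp: blinfun.scaleR_left)
    ultimately show "((\<lambda>x. t ^ j * F (c + t *\<^sub>R (x - c))) has_derivative blinfun_apply (?fx x t)) (at x within S)"
      using has_derivative_at_withinI by metis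
  next
    fix x assume x: "x \<in> S"
    have "continuous_on {0..1} (\<lambda>t. t ^ j * F (c + t *\<^sub>R (x - c)))"
      by (intro continuous_intros continuous_on_compose2[OF cF]) (use m x in auto)
    then show "(\<lambda>t. t ^ j * F (c + t *\<^sub>R (x - c))) integrable_on cbox 0 1"
      by (simp add: integrable_continuous_real)
  next
    show "continuous_on (S \<times> cbox 0 1) (\<lambda>(x, t). ?fx x t)" using cont by simp
  qed
  have D: "((\<lambda>x. integral {0..1} (\<lambda>t. t ^ j * F (c + t *\<^sub>R (x - c)))) has_derivative
      blinfun_apply (integral {0..1} (?fx x))) (at x)" if "x \<in> S" for x
    using L[OF that] unfolding at_within_open[OF that assms(1)] by simp
  have "blinfun_apply (integral {0..1} (?fx x)) v
      = integral {0..1} (\<lambda>t. t ^ Suc j * ?F' (c + t *\<^sub>R (x - c)) v)" if "x \<in> S" for x v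
  proof -
    have "blinfun_apply (integral {0..1} (?fx x)) v = integral {0..1} (\<lambda>t. blinfun_apply (?fx x t) v)"
      by (rule blinfun_apply_integral) (rule integrable_continuous_real[OF cx[OF that]])
    also have "\<dots> = integral {0..1} (\<lambda>t. t ^ Suc j * ?F' (c + t *\<^sub>R (x - c)) v)"
      using m that B by (intro integral_cong) (simp add: blinfun.scaleR_left)
    finally show ?thesis .
  qed
  moreover have "Ck_on k S (\<lambda>x. integral {0..1} (\<lambda>t. t ^ Suc j * ?F' (c + t *\<^sub>R (x - c)) v))" for v
    by (rule Suc.IH[of "\<lambda>y. ?F' y v"]) (use Suc.prems in simp)
  ultimately have "Ck_on k S (\<lambda>x. blinfun_apply (integral {0..1} (?fx x)) v)" for v
    by (metis (no_types, lifting) Ck_on_cong[OF assms(1)])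
  from Ck_on_SucI[OF assms(1) D this] show ?case .
qed

text \<open>The fundamental theorem of calculus along the segment from \<open>c\<close> to
  \<open>x\<close>, with the derivative in direction \<open>x - c\<close> expanded in the basis:
  \<open>G b x\<close> is the average of the \<open>b\<close>-th partial derivative over that
  segment.\<close>

lemma smooth_on_hadamard:
  fixes F :: "'e::euclidean_space \<Rightarrow> real"
  assumes S: "open S" "convex S" "c \<in> S" and F: "smooth_on S F"
  obtains G where "\<And>b. smooth_on S (G b)" "\<And>b. G b c = frechet_derivative F (at c) b"
    "\<And>x. x \<in> S \<Longrightarrow> F x = F c + (\<Sum>b\<in>Basis. ((x - c) \<bullet> b) * G b x)"
proof
  let ?F' = "\<lambda>y. frechet_derivative F (at y)"
  \<comment> \<open>The trivial factor \<open>t ^ 0\<close> makes this an instance of the lemma on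
    integrals with a parameter.\<close>
  define G where "G b x = integral {0..1} (\<lambda>t. t ^ 0 * ?F' (c + t *\<^sub>R (x - c)) b)" for b x
  have sF': "Ck_on k S (\<lambda>y. ?F' y b)" for k b
    using F unfolding smooth_on_def by (metis Ck_on.simps(2))
  have dF: "(F has_derivative ?F' y) (at y)" if "y \<in> S" for y
    using F that unfolding smooth_on_def by (metis Ck_on_has_derivative)
  show "smooth_on S (G b)" for b
    unfolding smooth_on_def G_def using Ck_on_parametric_integral[OF S sF'] by blast
  show "G b c = ?F' c b" for b
    by (simp add: G_def)
  fix x assume x: "x \<in> S"
  have m: "c + t *\<^sub>R (x - c) \<in> S" if "t \<in> {0..1}" for t
    using convexD[OF S(2,3) x, of "1 - t" t] that by (simp add: algebra_simps)
  have cF': "continuous_on {0..1} (\<lambda>t. ?F' (c + t *\<^sub>R (x - c)) b)" for b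
  proof -
    have "continuous_on S (\<lambda>y. ?F' y b)" using sF'[of 0] by simp
    then show ?thesis
      by (rule continuous_on_compose2) (use m in \<open>auto intro!: continuous_intros\<close>)
  qed
  have "((\<lambda>t. F (c + t *\<^sub>R (x - c))) has_vector_derivative ?F' (c + t *\<^sub>R (x - c)) (x - c)) (at t within {0..1})"
    if "t \<in> {0..1}" for t
  proof -
    have g: "((\<lambda>t. c + t *\<^sub>R (x - c)) has_derivative (\<lambda>s. s *\<^sub>R (x - c))) (at t)"
      by (auto intro!: derivative_eq_intros)
    have "((\<lambda>t. F (c + t *\<^sub>R (x - c))) has_derivative (\<lambda>s. ?F' (c + t *\<^sub>R (x - c)) (s *\<^sub>R (x - c)))) (at t)"
      using has_derivative_compose[OF g dF[OF m[OF that]]] .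
    moreover have "linear (?F' (c + t *\<^sub>R (x - c)))"
      using dF[OF m[OF that]] has_derivative_linear by blast
    ultimately show ?thesis
      by (simp add: has_vector_derivative_def linear_cmul has_derivative_at_withinI)
  qed
  then have "((\<lambda>t. ?F' (c + t *\<^sub>R (x - c)) (x - c)) has_integral F x - F c) {0..1}"
    using fundamental_theorem_of_calculus[of 0 1 "\<lambda>t. F (c + t *\<^sub>R (x - c))"] by simp
  moreover have "((\<lambda>t. \<Sum>b\<in>Basis. ((x - c) \<bullet> b) * ?F' (c + t *\<^sub>R (x - c)) b) has_integral
      (\<Sum>b\<in>Basis. ((x - c) \<bullet> b) * G b x)) {0..1}"
    unfolding G_def using cF'
    by (intro has_integral_sum has_integral_mult_right integrable_integral) (auto intro: integrable_continuous_real)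
  moreover have "?F' (c + t *\<^sub>R (x - c)) (x - c) = (\<Sum>b\<in>Basis. ((x - c) \<bullet> b) * ?F' (c + t *\<^sub>R (x - c)) b)"
    if "t \<in> {0..1}" for t
  proof -
    have "linear (?F' (c + t *\<^sub>R (x - c)))"
      using dF[OF m[OF that]] has_derivative_linear by blast
    then have "?F' (c + t *\<^sub>R (x - c)) (\<Sum>b\<in>Basis. ((x - c) \<bullet> b) *\<^sub>R b)
      = (\<Sum>b\<in>Basis. ((x - c) \<bullet> b) * ?F' (c + t *\<^sub>R (x - c)) b)"
      by (simp add: linear_sum linear_cmul del: euclidean_representation)
    then show ?thesis by (simp only: euclidean_representation)
  qed
  ultimately have "F x - F c = (\<Sum>b\<in>Basis. ((x - c) \<bullet> b) * G b x)"
    by (metis (no_types, lifting) has_integral_unique has_integral_eq)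
  then show "F x = F c + (\<Sum>b\<in>Basis. ((x - c) \<bullet> b) * G b x)" by simp
qed

section \<open>Local frames\<close>

lemma smooth_on_const: "open S \<Longrightarrow> smooth_on S (\<lambda>x. c)"
  by (simp add: smooth_on_def Ck_on_const)

lemma smooth_on_add:
  "open S \<Longrightarrow> smooth_on S f \<Longrightarrow> smooth_on S g \<Longrightarrow> smooth_on S (\<lambda>x. f x + g x)"
  by (simp add: smooth_on_def Ck_on_add)

lemma smooth_on_mult:
  fixes f g :: "_ \<Rightarrow> real"
  shows "open S \<Longrightarrow> smooth_on S f \<Longrightarrow> smooth_on S g \<Longrightarrow> smooth_on S (\<lambda>x. f x * g x)"
  by (simp add: smooth_on_def Ck_on_mult)

lemma smooth_on_sum:
  "open S \<Longrightarrow> (\<And>i. i \<in> I \<Longrightarrow> smooth_on S (f i)) \<Longrightarrow> smooth_on S (\<lambda>x. \<Sum>i\<in>I. f i x)"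
  by (simp add: smooth_on_def Ck_on_sum)

lemma smooth_on_inner: "open S \<Longrightarrow> smooth_on S (\<lambda>x. x \<bullet> b)"
  by (simp add: smooth_on_def Ck_on_linear bounded_linear_inner_left)

lemma smooth_on_subset: "smooth_on S f \<Longrightarrow> T \<subseteq> S \<Longrightarrow> smooth_on T f"
  by (auto simp: smooth_on_def intro: Ck_on_subset)

lemma smooth_on_has_derivative:
  "smooth_on S f \<Longrightarrow> x \<in> S \<Longrightarrow> (f has_derivative frechet_derivative f (at x)) (at x)"
  unfolding smooth_on_def by (metis Ck_on_has_derivative)

lemma smooth_on_frechet_derivative:
  "smooth_on S f \<Longrightarrow> smooth_on S (\<lambda>x. frechet_derivative f (at x) v)"
  unfolding smooth_on_def by (metis Ck_on.simps(2))

text \<open>The square of the distance is a polynomial in the coordinates, so the bump is smooth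
  also at its centre.\<close>

definition bump :: "'e::euclidean_space \<Rightarrow> real \<Rightarrow> 'e \<Rightarrow> real"
  where "bump c r x = flat_fun 0 (r\<^sup>2 - (dist c x)\<^sup>2)"

lemma smooth_on_bump: "open S \<Longrightarrow> smooth_on S (bump c r)"
proof -
  assume S: "open S"
  have d: "(dist c x)\<^sup>2 = (\<Sum>b\<in>Basis. (x \<bullet> b - c \<bullet> b) * (x \<bullet> b - c \<bullet> b))" for x
  proof -
    have "(dist c x)\<^sup>2 = (x - c) \<bullet> (x - c)"
      by (simp add: dist_norm norm_minus_commute[of c] power2_norm_eq_inner)
    also have "\<dots> = (\<Sum>b\<in>Basis. ((x - c) \<bullet> b) * ((x - c) \<bullet> b))"
      by (rule euclidean_inner)
    finally show ?thesis by (simp only: inner_diff_left)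
  qed
  have e: "bump c r = (\<lambda>x. flat_fun 0 (r\<^sup>2 + (\<Sum>b\<in>Basis. (- 1) * ((x \<bullet> b + (- (c \<bullet> b))) * (x \<bullet> b + (- (c \<bullet> b)))))))"
    by (simp add: bump_def fun_eq_iff d sum_negf)
  have "smooth_on S (\<lambda>x. r\<^sup>2 + (\<Sum>b\<in>Basis. (- 1) * ((x \<bullet> b + (- (c \<bullet> b))) * (x \<bullet> b + (- (c \<bullet> b))))))"
    using S by (intro smooth_on_add smooth_on_sum smooth_on_mult smooth_on_const smooth_on_inner)
  then show ?thesis
    unfolding e smooth_on_def using Ck_on_compose[OF S _ Ck_on_flat_fun[of _ 0]] by blast
qed

lemma bump_pos: "dist c x < r \<Longrightarrow> bump c r x > 0"
  by (simp add: bump_def flat_fun_def power_strict_mono)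

lemma bump_eq_0: "0 \<le> r \<Longrightarrow> r \<le> dist c x \<Longrightarrow> bump c r x = 0"
  using power_mono[of r "dist c x" 2] by (simp add: bump_def flat_fun_def not_less)

lemma sum_fun_apply: "(\<Sum>i\<in>I. f i) x = (\<Sum>i\<in>I. f i x)"
  by (induction I rule: infinite_finite_induct) auto

lemma scaleR_fun_apply: "(c *\<^sub>R f) x = c *\<^sub>R f x"
  by (simp add: scaleR_fun_def)

lemma sum_fun_scaleR_apply: "(\<Sum>b\<in>I. k b *\<^sub>R B b) f = (\<Sum>b\<in>I. k b * (B b f :: real))"
  by (induction I rule: infinite_finite_induct) (auto simp: scaleR_fun_def)

section \<open>Smooth functions and derivations on a manifold\<close>

context
  fixes A :: "('a::{t2_space, second_countable_topology}, 'e::euclidean_space) atlas"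
  assumes A: "smooth_manifold A"
begin

lemma chart_open: "(U, \<psi>) \<in> A \<Longrightarrow> open U" "(U, \<psi>) \<in> A \<Longrightarrow> open (\<psi> ` U)"
  and chart_homeo: "(U, \<psi>) \<in> A \<Longrightarrow> homeomorphism U (\<psi> ` U) \<psi> (inv_into U \<psi>)"
  and chart_smooth: "(U, \<psi>) \<in> A \<Longrightarrow> (W, \<theta>) \<in> A \<Longrightarrow> smooth_on (\<psi> ` (U \<inter> W)) (\<theta> \<circ> inv_into U \<psi>)"
  and chart_cover: "\<exists>(U, \<psi>) \<in> A. p \<in> U"
  using A unfolding smooth_manifold_def by fast+

lemma chart_inv:
  assumes "(U, \<psi>) \<in> A"
  shows "q \<in> U \<Longrightarrow> inv_into U \<psi> (\<psi> q) = q" "x \<in> \<psi> ` U \<Longrightarrow> \<psi> (inv_into U \<psi> x) = x"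
    "x \<in> \<psi> ` U \<Longrightarrow> inv_into U \<psi> x \<in> U"
  using chart_homeo[OF assms] by (auto simp: homeomorphism_def)

lemma smooth_funI:
  "(\<And>U \<psi>. (U, \<psi>) \<in> A \<Longrightarrow> smooth_on (\<psi> ` U) (\<lambda>x. f (inv_into U \<psi> x))) \<Longrightarrow> smooth_fun A f"
  by (auto simp: smooth_fun_def o_def)

lemma smooth_funD: "smooth_fun A f \<Longrightarrow> (U, \<psi>) \<in> A \<Longrightarrow> smooth_on (\<psi> ` U) (\<lambda>x. f (inv_into U \<psi> x))"
  by (auto simp: smooth_fun_def o_def)

lemma smooth_fun_const: "smooth_fun A (\<lambda>_. k)"
  by (rule smooth_funI) (rule smooth_on_const[OF chart_open(2)])

lemma smooth_fun_add: "smooth_fun A f \<Longrightarrow> smooth_fun A g \<Longrightarrow> smooth_fun A (\<lambda>q. f q + g q)"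
  by (rule smooth_funI) (rule smooth_on_add[OF chart_open(2) smooth_funD smooth_funD])

lemma smooth_fun_mult: "smooth_fun A f \<Longrightarrow> smooth_fun A g \<Longrightarrow> smooth_fun A (\<lambda>q. f q * g q)"
  by (rule smooth_funI) (rule smooth_on_mult[OF chart_open(2) smooth_funD smooth_funD])

lemma smooth_fun_cmult: "smooth_fun A f \<Longrightarrow> smooth_fun A (\<lambda>q. k * f q)"
  by (intro smooth_fun_mult smooth_fun_const)

lemma smooth_fun_diff: "smooth_fun A f \<Longrightarrow> smooth_fun A g \<Longrightarrow> smooth_fun A (\<lambda>q. f q - g q)"
  using smooth_fun_add[OF _ smooth_fun_cmult[of g "- 1"]] by simp

lemma smooth_fun_sum:
  "(\<And>i. i \<in> I \<Longrightarrow> smooth_fun A (f i)) \<Longrightarrow> smooth_fun A (\<lambda>q. \<Sum>i\<in>I. f i q)"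
  by (rule smooth_funI) (rule smooth_on_sum[OF chart_open(2) smooth_funD])

lemma tangent_nonsmooth: "v \<in> tangent_space A p \<Longrightarrow> \<not> smooth_fun A f \<Longrightarrow> v f = 0"
  and tangent_lin: "v \<in> tangent_space A p \<Longrightarrow> smooth_fun A f \<Longrightarrow> smooth_fun A g \<Longrightarrow>
    v (\<lambda>q. a * f q + b * g q) = a * v f + b * v g"
  and tangent_mult: "v \<in> tangent_space A p \<Longrightarrow> smooth_fun A f \<Longrightarrow> smooth_fun A g \<Longrightarrow>
    v (\<lambda>q. f q * g q) = f p * v g + g p * v f"
  by (simp_all add: tangent_space_def)

lemma tangent_add: "v \<in> tangent_space A p \<Longrightarrow> smooth_fun A f \<Longrightarrow> smooth_fun A g \<Longrightarrow>
    v (\<lambda>q. f q + g q) = v f + v g"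
  using tangent_lin[of v p f g 1 1] by simp

lemma tangent_diff: "v \<in> tangent_space A p \<Longrightarrow> smooth_fun A f \<Longrightarrow> smooth_fun A g \<Longrightarrow>
    v (\<lambda>q. f q - g q) = v f - v g"
  using tangent_lin[of v p f g 1 "- 1"] by simp

lemma tangent_cmult: "v \<in> tangent_space A p \<Longrightarrow> smooth_fun A f \<Longrightarrow> v (\<lambda>q. k * f q) = k * v f"
  using tangent_lin[of v p f f k 0] by simp

text \<open>From 1 * 1 = 1 the Leibniz rule gives v(1) = 2 v(1).\<close>

lemma tangent_const: "v \<in> tangent_space A p \<Longrightarrow> v (\<lambda>q. k) = 0"
  using tangent_mult[of v p "\<lambda>_. 1" "\<lambda>_. 1"] tangent_cmult[of v p "\<lambda>_. 1" k] smooth_fun_const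
  by simp

lemma tangent_sum:
  assumes "v \<in> tangent_space A p"
  shows "(\<And>i. i \<in> I \<Longrightarrow> smooth_fun A (f i)) \<Longrightarrow> v (\<lambda>q. \<Sum>i\<in>I. f i q) = (\<Sum>i\<in>I. v (f i))"
  by (induction I rule: infinite_finite_induct)
     (simp_all add: tangent_const[OF assms] tangent_add[OF assms] smooth_fun_sum)

text \<open>\<open>u\<close> vanishes off a closed ball, whose preimage is compact and hence closed
  in the manifold, the space being Hausdorff. The chart piece over \<open>T\<close> and the
  complement of this preimage are two open sets covering the manifold: on the first the function is
  \<open>u\<close> read through a transition map, on the second it is 0.\<close>

lemma smooth_fun_extend:
  assumes U: "(U, \<psi>) \<in> A" and T: "open T" "cball c r \<subseteq> T" "T \<subseteq> \<psi> ` U"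
    and u: "smooth_on T u" "\<And>x. x \<in> T \<Longrightarrow> x \<notin> cball c r \<Longrightarrow> u x = 0"
  shows "smooth_fun A (\<lambda>q. if q \<in> U \<and> \<psi> q \<in> T then u (\<psi> q) else 0)" (is "smooth_fun A ?F")
proof (rule smooth_funI)
  fix W \<theta> assume W: "(W, \<theta>) \<in> A"
  define K where "K = inv_into U \<psi> ` cball c r"
  define O' where "O' = U \<inter> \<psi> -` T"
  have hU: "continuous_on U \<psi>" "continuous_on (\<psi> ` U) (inv_into U \<psi>)"
    and hW: "continuous_on (\<theta> ` W) (inv_into W \<theta>)"
    using chart_homeo[OF U] chart_homeo[OF W] by (auto simp: homeomorphism_def)
  have "compact K"
    unfolding K_def using T(2,3) continuous_on_subset[OF hU(2)]
    by (intro compact_continuous_image) auto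
  then have K: "closed K" by (rule compact_imp_closed)
  have O': "open O'"
    using continuous_openin_preimage[OF hU(1), of T] continuous_on_open_vimage[OF chart_open(1)[OF U]] hU(1) T(1)
    by (metis O'_def Int_commute)
  have img: "open (\<theta> ` (W \<inter> N))" if "open N" for N
  proof -
    have "\<theta> ` (W \<inter> N) = inv_into W \<theta> -` N \<inter> \<theta> ` W"
      using chart_inv[OF W] by force
    then show ?thesis
      using continuous_on_open_vimage[OF chart_open(2)[OF W]] hW that by metis
  qed
  show "smooth_on (\<theta> ` W) (\<lambda>x. ?F (inv_into W \<theta> x))"
    unfolding smooth_on_def
  proof (intro allI Ck_on_local)
    fix k x assume "x \<in> \<theta> ` W"
    then obtain w where w: "w \<in> W" "x = \<theta> w" by blast
    show "\<exists>N. open N \<and> x \<in> N \<and> Ck_on k N (\<lambda>x. ?F (inv_into W \<theta> x))"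
    proof (cases "w \<in> O'")
      case True
      let ?N = "\<theta> ` (W \<inter> O')"
      have N: "open ?N" using img[OF O'] .
      have "smooth_on ?N (\<lambda>x. \<psi> (inv_into W \<theta> x))"
        using smooth_on_subset[OF chart_smooth[OF W U], of ?N] by (auto simp: O'_def o_def)
      then have "Ck_on k ?N (\<lambda>x. u (\<psi> (inv_into W \<theta> x)))"
        using u(1) chart_inv[OF W]
        by (intro Ck_on_compose[OF N, of _ T]) (auto simp: smooth_on_def O'_def)
      then have "Ck_on k ?N (\<lambda>x. ?F (inv_into W \<theta> x))"
        by (rule Ck_on_cong[OF N, rotated]) (use chart_inv[OF W] in \<open>auto simp: O'_def\<close>)
      then show ?thesis using N w True by blast
    next
      case False
      have KO: "q \<notin> K \<Longrightarrow> ?F q = 0" for q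
        using u(2)[of "\<psi> q"] chart_inv(1)[OF U, of q] unfolding K_def by (metis imageI)
      have "w \<notin> K"
      proof
        assume "w \<in> K"
        then obtain x where "x \<in> cball c r" "w = inv_into U \<psi> x" unfolding K_def by blast
        moreover from this have "x \<in> T" "x \<in> \<psi> ` U" using T by blast+
        ultimately show False
          using False chart_inv(2,3)[OF U, of x] unfolding O'_def by simp
      qed
      let ?N = "\<theta> ` (W \<inter> - K)"
      have N: "open ?N" using img K by blast
      have "Ck_on k ?N (\<lambda>x. ?F (inv_into W \<theta> x))"
        by (rule Ck_on_cong[OF N _ Ck_on_const[OF N, of _ 0]]) (use chart_inv[OF W] KO in force)
      then show ?thesis using N w \<open>w \<notin> K\<close> by blast
    qed
  qed
qed

text \<open>
  The coordinate fields and coordinate functions of a chart are cut off by the same bump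
  function \<open>\<beta>\<close>; no plateau function is needed, because the coordinates \<open>\<beta>\<^sup>2 v\<close> can be recovered
  from \<open>v(\<beta> x\<^sub>b)\<close> and \<open>v \<beta>\<close> by the Leibniz rule. This gives the factor \<open>\<zeta> = \<beta>\<^sup>3\<close>.
\<close>

lemma local_frame:
  obtains \<zeta> :: "'a \<Rightarrow> real" and co :: "'e \<Rightarrow> 'a \<Rightarrow> 'a tvec \<Rightarrow> real" and B :: "'e \<Rightarrow> 'a vfield"
  where "\<zeta> p \<noteq> 0" "\<And>b. b \<in> Basis \<Longrightarrow> B b \<in> vector_fields A"
    "\<And>q v. v \<in> tangent_space A q \<Longrightarrow> \<zeta> q *\<^sub>R v = (\<Sum>b\<in>Basis. co b q v *\<^sub>R B b q)"
    "\<And>b b'. b \<in> Basis \<Longrightarrow> b' \<in> Basis \<Longrightarrow> co b p (B b' p) = (if b = b' then \<zeta> p else 0)"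
    "\<And>b q. lin_on UNIV (co b q)"
proof -
  obtain U \<psi> where U: "(U, \<psi>) \<in> A" and p: "p \<in> U"
    using chart_cover by blast
  define c where "c = \<psi> p"
  obtain R where R: "R > 0" "ball c R \<subseteq> \<psi> ` U"
    using chart_open(2)[OF U] p openE unfolding c_def by blast
  define T where "T = ball c R"
  define r where "r = R / 2"
  have T: "open T" "convex T" "cball c r \<subseteq> T" "T \<subseteq> \<psi> ` U" "c \<in> T" and r: "r > 0"
    using R by (auto simp: T_def r_def)
  define \<beta> where "\<beta> = bump c r"
  define ext :: "('e \<Rightarrow> real) \<Rightarrow> 'a \<Rightarrow> real"
    where "ext u q = (if q \<in> U \<and> \<psi> q \<in> T then u (\<psi> q) else 0)" for u q
  have \<beta>: "smooth_on T \<beta>" "\<beta> c > 0" "\<And>x. x \<notin> cball c r \<Longrightarrow> \<beta> x = 0"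
    using T r by (auto simp: \<beta>_def smooth_on_bump bump_pos bump_eq_0)
  have ext: "smooth_fun A (ext (\<lambda>x. \<beta> x * u x))" if "smooth_on T u" for u
    unfolding ext_def
    by (rule smooth_fun_extend[OF U T(1,3,4)]) (use T \<beta> that smooth_on_mult in auto)
  define \<gamma> where "\<gamma> = ext (\<lambda>x. \<beta> x * 1)"
  define y where "y b = ext (\<lambda>x. \<beta> x * (x \<bullet> b))" for b
  have \<gamma>: "smooth_fun A \<gamma>" and y: "smooth_fun A (y b)" for b
    unfolding \<gamma>_def y_def by (rule ext[OF smooth_on_const[OF T(1)]], rule ext[OF smooth_on_inner[OF T(1)]])
  let ?c = "\<lambda>f x. f (inv_into U \<psi> x)"
  let ?D = "\<lambda>f x. frechet_derivative (?c f) (at x)"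
  \<comment> \<open>The coordinate derivative times the cut-off. The value 0 on functions that are
    not smooth is the normalisation required in \<open>tangent_space\<close>.\<close>
  define B where "B b q f = (if smooth_fun A f then ext (\<lambda>x. \<beta> x * ?D f x b) q else 0)" for b q f
  \<comment> \<open>If x is the \<open>b\<close>-th coordinate, then \<open>y b\<close> is formally
    \<open>\<gamma>\<close> times x, and the Leibniz rule turns this expression into the square of
    \<open>\<gamma>\<close> times v(x). The cut-off in \<open>B\<close> supplies the third
    factor.\<close>
  define co where "co b q v = \<gamma> q * v (y b) - y b q * v \<gamma>" for b q and v :: "'a tvec"
  have sT: "smooth_on T (?c f)" if "smooth_fun A f" for f
    using smooth_on_subset[OF smooth_funD[OF that U] T(4)] .
  have hd: "(?c f has_derivative ?D f x) (at x)" if "smooth_fun A f" "x \<in> T" for f x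
    using smooth_on_has_derivative[OF sT[OF that(1)] that(2)] .
  have BT: "B b q \<in> tangent_space A q" for b q
  proof (cases "q \<in> U \<and> \<psi> q \<in> T")
    case True
    then have iq: "inv_into U \<psi> (\<psi> q) = q" and qT: "\<psi> q \<in> T" using chart_inv[OF U] by auto
    have "?D (\<lambda>x. a * f x + k * g x) (\<psi> q) b = a * ?D f (\<psi> q) b + k * ?D g (\<psi> q) b"
      if "smooth_fun A f" "smooth_fun A g" for f g a k
    proof -
      have "((\<lambda>x. a * ?c f x + k * ?c g x) has_derivative (\<lambda>v. a * ?D f (\<psi> q) v + k * ?D g (\<psi> q) v)) (at (\<psi> q))"
        using hd[OF that(1) qT] hd[OF that(2) qT] by (intro derivative_intros)
      from fun_cong[OF frechet_derivative_at[OF this], of b] show ?thesis by simp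
    qed
    moreover have "?D (\<lambda>x. f x * g x) (\<psi> q) b = f q * ?D g (\<psi> q) b + g q * ?D f (\<psi> q) b"
      if "smooth_fun A f" "smooth_fun A g" for f g
    proof -
      have "((\<lambda>x. ?c f x * ?c g x) has_derivative (\<lambda>v. ?c f (\<psi> q) * ?D g (\<psi> q) v + ?D f (\<psi> q) v * ?c g (\<psi> q))) (at (\<psi> q))"
        using hd[OF that(1) qT] hd[OF that(2) qT] by (rule has_derivative_mult)
      from fun_cong[OF frechet_derivative_at[OF this], of b] show ?thesis by (simp add: iq mult.commute)
    qed
    ultimately show ?thesis
      using True
      by (auto simp: tangent_space_def B_def ext_def smooth_fun_add smooth_fun_mult smooth_fun_const algebra_simps)
  next
    case False
    then show ?thesis by (auto simp: tangent_space_def B_def ext_def)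
  qed
  have BV: "B b \<in> vector_fields A" for b
    unfolding vector_fields_def deriv_along_def using BT ext smooth_on_frechet_derivative[OF sT]
    by (simp add: B_def)
  have exp: "\<gamma> q ^ 3 *\<^sub>R v = (\<Sum>b\<in>Basis. co b q v *\<^sub>R B b q)" if v: "v \<in> tangent_space A q" for q v
  proof
    fix f
    show "(\<gamma> q ^ 3 *\<^sub>R v) f = (\<Sum>b\<in>Basis. co b q v *\<^sub>R B b q) f"
    proof (cases "smooth_fun A f \<and> \<gamma> q \<noteq> 0")
      case False
      then consider "\<not> smooth_fun A f" | "\<gamma> q = 0" by blast
      then show ?thesis
      proof cases
        case 1
        then show ?thesis using tangent_nonsmooth[OF v]
          by (simp add: sum_fun_scaleR_apply scaleR_fun_apply B_def)
      next
        case 2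
        then have "y b q = 0" for b by (auto simp: y_def \<gamma>_def ext_def split: if_splits)
        then show ?thesis using 2 by (simp add: sum_fun_scaleR_apply scaleR_fun_apply co_def)
      qed
    next
      case True
      then have f: "smooth_fun A f" and q: "q \<in> U" "\<psi> q \<in> T"
        by (auto simp: \<gamma>_def ext_def split: if_splits)
      let ?x = "\<psi> q"
      obtain G where G: "\<And>b. smooth_on T (G b)" "\<And>b. G b ?x = ?D f ?x b"
        and G_eq: "\<And>x. x \<in> T \<Longrightarrow> ?c f x = ?c f ?x + (\<Sum>b\<in>Basis. ((x - ?x) \<bullet> b) * G b x)"
        using smooth_on_hadamard[OF T(1,2) q(2) sT[OF f]] by blast
      define e where "e b = ext (\<lambda>x. \<beta> x * G b x)" for b
      have e: "smooth_fun A (e b)" for b unfolding e_def by (rule ext[OF G(1)])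
      have fq: "?c f ?x = f q" using chart_inv[OF U] q by simp
      have yq: "y b q = \<gamma> q * (?x \<bullet> b)" for b
        using q by (simp add: y_def \<gamma>_def ext_def)
      \<comment> \<open>Hadamard's expansion of \<open>f\<close> about \<open>\<psi> q\<close>,
        multiplied by the square of the cut-off. Every factor is now a globally smooth function and
        the identity holds on the whole manifold, so \<open>v\<close> may be applied to it.\<close>
      have id: "(\<lambda>z. (\<gamma> z * \<gamma> z) * f z)
        = (\<lambda>z. f q * (\<gamma> z * \<gamma> z) + (\<Sum>b\<in>Basis. (y b z - (?x \<bullet> b) * \<gamma> z) * e b z))"
      proof
        fix z
        show "(\<gamma> z * \<gamma> z) * f z = f q * (\<gamma> z * \<gamma> z) + (\<Sum>b\<in>Basis. (y b z - (?x \<bullet> b) * \<gamma> z) * e b z)"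
        proof (cases "z \<in> U \<and> \<psi> z \<in> T")
          case True
          then have "f z = f q + (\<Sum>b\<in>Basis. ((\<psi> z - ?x) \<bullet> b) * G b (\<psi> z))"
            using G_eq[of "\<psi> z"] chart_inv[OF U] fq by simp
          then show ?thesis
            using True by (simp add: \<gamma>_def y_def e_def ext_def algebra_simps sum_distrib_left)
        next
          case False
          then show ?thesis by (auto simp: \<gamma>_def y_def e_def ext_def)
        qed
      qed
      have d: "smooth_fun A (\<lambda>z. y b z - (?x \<bullet> b) * \<gamma> z)" for b
        by (intro smooth_fun_diff smooth_fun_cmult y \<gamma>)
      have "v (\<lambda>z. (\<gamma> z * \<gamma> z) * f z) = \<gamma> q * \<gamma> q * v f + f q * v (\<lambda>z. \<gamma> z * \<gamma> z)"
        by (simp add: tangent_mult[OF v] smooth_fun_mult \<gamma> f)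
      \<comment> \<open>The factor multiplying \<open>e b\<close> vanishes at \<open>q\<close>, so
        the Leibniz rule keeps only the term in which that factor is differentiated.\<close>
      moreover have "v (\<lambda>z. f q * (\<gamma> z * \<gamma> z) + (\<Sum>b\<in>Basis. (y b z - (?x \<bullet> b) * \<gamma> z) * e b z))
        = f q * v (\<lambda>z. \<gamma> z * \<gamma> z) + (\<Sum>b\<in>Basis. e b q * (v (y b) - (?x \<bullet> b) * v \<gamma>))"
        by (simp add: tangent_add[OF v] tangent_sum[OF v] tangent_cmult[OF v] tangent_diff[OF v]
            tangent_mult[OF v, OF d e] smooth_fun_mult smooth_fun_sum smooth_fun_cmult d e y \<gamma> yq)
      ultimately have "\<gamma> q * \<gamma> q * v f = (\<Sum>b\<in>Basis. e b q * (v (y b) - (?x \<bullet> b) * v \<gamma>))"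
        unfolding id by simp
      then have "\<gamma> q ^ 3 * v f = (\<Sum>b\<in>Basis. \<gamma> q * (e b q * (v (y b) - (?x \<bullet> b) * v \<gamma>)))"
        by (simp add: power3_eq_cube sum_distrib_left[symmetric] mult.assoc)
      also have "\<dots> = (\<Sum>b\<in>Basis. co b q v * B b q f)"
      proof (rule sum.cong[OF refl])
        fix b
        have "e b q = B b q f" using f q G(2) by (simp add: e_def B_def ext_def)
        then show "\<gamma> q * (e b q * (v (y b) - (?x \<bullet> b) * v \<gamma>)) = co b q v * B b q f"
          by (simp add: co_def yq algebra_simps)
      qed
      finally show ?thesis by (simp add: sum_fun_scaleR_apply scaleR_fun_apply)
    qed
  qed
  have dual: "co b p (B b' p) = (if b = b' then \<gamma> p ^ 3 else 0)" if "b \<in> Basis" "b' \<in> Basis" for b b'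
  proof -
    let ?d = "frechet_derivative \<beta> (at c)"
    have d: "(\<beta> has_derivative ?d) (at c)"
      using smooth_on_has_derivative[OF \<beta>(1) T(5)] .
    have pt: "ext u p = u c" for u using p T(5) by (simp add: ext_def c_def)
    have near: "?c (ext u) x = u x" if "x \<in> T" for u x
      using that T(4) chart_inv[OF U] by (auto simp: ext_def subset_iff)
    have "(?c \<gamma> has_derivative ?d) (at c)"
      by (rule has_derivative_transform_within_open[OF d T(1,5)]) (simp add: \<gamma>_def near)
    then have 1: "?D \<gamma> c = ?d" by (rule frechet_derivative_at[symmetric])
    have "((\<lambda>x. \<beta> x * (x \<bullet> b)) has_derivative (\<lambda>v. \<beta> c * (v \<bullet> b) + ?d v * (c \<bullet> b))) (at c)"
      by (rule has_derivative_mult[OF d has_derivative_inner_left[OF has_derivative_ident]])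
    then have "(?c (y b) has_derivative (\<lambda>v. \<beta> c * (v \<bullet> b) + ?d v * (c \<bullet> b))) (at c)"
      by (rule has_derivative_transform_within_open[OF _ T(1,5)]) (simp add: y_def near)
    then have 2: "?D (y b) c = (\<lambda>v. \<beta> c * (v \<bullet> b) + ?d v * (c \<bullet> b))"
      by (rule frechet_derivative_at[symmetric])
    have g: "\<gamma> p = \<beta> c" "y b p = \<beta> c * (c \<bullet> b)" by (simp_all add: \<gamma>_def y_def pt)
    have "B b' p \<gamma> = \<beta> c * ?d b'" "B b' p (y b) = \<beta> c * (\<beta> c * (b' \<bullet> b) + ?d b' * (c \<bullet> b))"
      by (simp_all add: B_def \<gamma> y pt 1 2)
    \<comment> \<open>The two terms containing the derivative of \<open>\<beta>\<close> cancel,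
      leaving the cube of \<open>\<beta> c\<close> times the inner product of two basis
      vectors.\<close>
    then show ?thesis
      using that by (simp add: co_def g inner_Basis power3_eq_cube algebra_simps)
  qed
  show ?thesis
  proof (rule that[of "\<lambda>q. \<gamma> q ^ 3" B co])
    show "\<gamma> p ^ 3 \<noteq> 0" using p \<beta> T(5) by (simp add: \<gamma>_def ext_def c_def[symmetric])
    show "lin_on UNIV (co b q)" for b q
      by (auto simp: lin_on_def co_def scaleR_fun_def algebra_simps)
  qed (use BV exp dual in auto)
qed

end

section \<open>Orthonormal bases\<close>

lemma lin_onD:
  "lin_on T F \<Longrightarrow> v \<in> T \<Longrightarrow> w \<in> T \<Longrightarrow> F (v + w) = F v + F w"
  "lin_on T F \<Longrightarrow> v \<in> T \<Longrightarrow> F (a *\<^sub>R v) = a *\<^sub>R F v"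
  unfolding lin_on_def
  by (metis scaleR_one, metis (no_types, lifting) add.right_neutral scaleR_zero_left)

lemma lin_on_UNIV: "lin_on UNIV F \<Longrightarrow> linear F"
  by (rule linearI) (simp_all add: lin_onD)

section \<open>Gram-Schmidt in a subspace with an inner product\<close>

text \<open>Stated relative to a set \<open>T\<close> because a tangent space is only a subspace of
  the type of all functionals, and the metric is unconstrained outside it.\<close>

definition orthonormal_family :: "'v set \<Rightarrow> ('v \<Rightarrow> 'v \<Rightarrow> real) \<Rightarrow> nat \<Rightarrow> (nat \<Rightarrow> 'v) \<Rightarrow> bool"
  where "orthonormal_family T g k e \<longleftrightarrow>
    (\<forall>i<k. e i \<in> T) \<and> (\<forall>i<k. \<forall>j<k. g (e i) (e j) = (if i = j then 1 else 0))"

context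
  fixes T :: "'v::real_vector set" and g :: "'v \<Rightarrow> 'v \<Rightarrow> real"
  assumes T: "subspace T"
    and g_lin: "\<And>v. v \<in> T \<Longrightarrow> lin_on T (g v)"
    and g_sym: "\<And>v w. v \<in> T \<Longrightarrow> w \<in> T \<Longrightarrow> g v w = g w v"
    and g_pos: "\<And>v. v \<in> T \<Longrightarrow> v \<noteq> 0 \<Longrightarrow> g v v > 0"
begin

lemma inner_lin:
  shows "v \<in> T \<Longrightarrow> w \<in> T \<Longrightarrow> x \<in> T \<Longrightarrow> g v (w + x) = g v w + g v x"
    and "v \<in> T \<Longrightarrow> w \<in> T \<Longrightarrow> g v (a *\<^sub>R w) = a * g v w"
    and "v \<in> T \<Longrightarrow> g v 0 = 0"
    and "v \<in> T \<Longrightarrow> w \<in> T \<Longrightarrow> x \<in> T \<Longrightarrow> g (w + x) v = g w v + g x v"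
    and "v \<in> T \<Longrightarrow> w \<in> T \<Longrightarrow> g (a *\<^sub>R w) v = a * g w v"
    and "v \<in> T \<Longrightarrow> g 0 v = 0"
proof -
  show add: "g v (w + x) = g v w + g v x" if "v \<in> T" "w \<in> T" "x \<in> T" for v w x
    using lin_onD(1)[OF g_lin] that by blast
  show scale: "g v (a *\<^sub>R w) = a * g v w" if "v \<in> T" "w \<in> T" for v w a
    using lin_onD(2)[OF g_lin] that by simp
  show zero: "g v 0 = 0" if "v \<in> T" for v using scale[OF that that, of 0] by simp
  show "g (w + x) v = g w v + g x v" if "v \<in> T" "w \<in> T" "x \<in> T"
    using add[OF that] g_sym that subspace_add[OF T] by simp
  show "g (a *\<^sub>R w) v = a * g w v" if "v \<in> T" "w \<in> T"
    using scale[OF that] g_sym that subspace_scale[OF T] by simp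
  show "g 0 v = 0" if "v \<in> T"
    using zero[OF that] g_sym that subspace_0[OF T] by simp
qed

lemma inner_sum:
  assumes "v \<in> T"
  shows "(\<And>i. i \<in> I \<Longrightarrow> e i \<in> T) \<Longrightarrow> g v (\<Sum>i\<in>I. k i *\<^sub>R e i) = (\<Sum>i\<in>I. k i * g v (e i))"
  by (induction I rule: infinite_finite_induct)
     (simp_all add: inner_lin assms subspace_scale[OF T] subspace_sum[OF T])

text \<open>Pairing with \<open>e i\<close> annihilates the span of the other members but not
  \<open>e i\<close> itself.\<close>

lemma orthonormal_family_independent:
  assumes "orthonormal_family T g k e"
  shows "independent (e ` {..<k})" "card (e ` {..<k}) = k"
proof -
  have e: "\<And>i. i < k \<Longrightarrow> e i \<in> T" "\<And>i j. i < k \<Longrightarrow> j < k \<Longrightarrow> g (e i) (e j) = (if i = j then 1 else 0)"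
    using assms by (auto simp: orthonormal_family_def)
  have "inj_on e {..<k}"
    using e(2) by (intro inj_onI) (metis lessThan_iff zero_neq_one)
  then show "card (e ` {..<k}) = k" by (simp add: card_image)
  show "independent (e ` {..<k})"
    unfolding dependent_def
  proof safe
    fix i assume i: "i < k" and s: "e i \<in> span (e ` {..<k} - {e i})"
    have "e i \<in> T \<and> g (e i) (e i) = 0"
      by (rule span_induct[OF s, where P="\<lambda>x. x \<in> T \<and> g (e i) x = 0"])
        (use e i T in \<open>auto simp: subspace_def inner_lin\<close>)
    then show False using e(2)[OF i i] by simp
  qed
qed

text \<open>The vectors equal to their own expansion form a subspace that contains every
  \<open>e i\<close>.\<close>

lemma orthonormal_family_expand:
  assumes e: "orthonormal_family T g k e" and v: "v \<in> span (e ` {..<k})"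
  shows "v = (\<Sum>i<k. g v (e i) *\<^sub>R e i)"
proof -
  have eT: "\<And>i. i < k \<Longrightarrow> e i \<in> T"
    using e by (auto simp: orthonormal_family_def)
  have "v \<in> T \<and> v = (\<Sum>i<k. g v (e i) *\<^sub>R e i)"
  proof (rule span_induct[OF v, where P="\<lambda>v. v \<in> T \<and> v = (\<Sum>i<k. g v (e i) *\<^sub>R e i)"])
    show "subspace {v. v \<in> T \<and> v = (\<Sum>i<k. g v (e i) *\<^sub>R e i)}"
      unfolding subspace_def mem_Collect_eq
    proof (intro conjI ballI allI)
      show "0 = (\<Sum>i<k. g 0 (e i) *\<^sub>R e i)"
        by (simp add: inner_lin[OF eT])
    next
      fix x y assume "x \<in> {v. v \<in> T \<and> v = (\<Sum>i<k. g v (e i) *\<^sub>R e i)}"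
        "y \<in> {v. v \<in> T \<and> v = (\<Sum>i<k. g v (e i) *\<^sub>R e i)}"
      then have x: "x \<in> T" "x = (\<Sum>i<k. g x (e i) *\<^sub>R e i)" and y: "y \<in> T" "y = (\<Sum>i<k. g y (e i) *\<^sub>R e i)"
        by blast+
      have "(\<Sum>i<k. g (x + y) (e i) *\<^sub>R e i) = (\<Sum>i<k. g x (e i) *\<^sub>R e i) + (\<Sum>i<k. g y (e i) *\<^sub>R e i)"
        using x(1) y(1) eT by (simp add: inner_lin scaleR_add_left sum.distrib)
      then show "x + y = (\<Sum>i<k. g (x + y) (e i) *\<^sub>R e i)" using x y by simp
    next
      fix c x assume "x \<in> {v. v \<in> T \<and> v = (\<Sum>i<k. g v (e i) *\<^sub>R e i)}"
      then have x: "x \<in> T" "x = (\<Sum>i<k. g x (e i) *\<^sub>R e i)" by blast+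
      have "(\<Sum>i<k. g (c *\<^sub>R x) (e i) *\<^sub>R e i) = c *\<^sub>R (\<Sum>i<k. g x (e i) *\<^sub>R e i)"
        using x(1) eT by (simp add: inner_lin scaleR_sum_right)
      then show "c *\<^sub>R x = (\<Sum>i<k. g (c *\<^sub>R x) (e i) *\<^sub>R e i)" using x by simp
    qed (use T subspace_0 subspace_add subspace_scale in auto)
  next
    fix v assume "v \<in> e ` {..<k}"
    then obtain j where j: "j < k" "v = e j" by blast
    have "(\<Sum>i<k. g v (e i) *\<^sub>R e i) = (\<Sum>i<k. if i = j then e i else 0)"
      using e j by (intro sum.cong) (auto simp: orthonormal_family_def)
    then show "v \<in> T \<and> v = (\<Sum>i<k. g v (e i) *\<^sub>R e i)" using j eT by simp
  qed
  then show ?thesis by blast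
qed

text \<open>Otherwise adjoining \<open>v\<close> would give k + 1 independent vectors in the span of
  k vectors.\<close>

lemma orthonormal_family_spans:
  assumes e: "orthonormal_family T g k e" and W: "finite W" "card W = k" "T \<subseteq> span W" and v: "v \<in> T"
  shows "v = (\<Sum>i<k. g v (e i) *\<^sub>R e i)"
proof -
  note i = orthonormal_family_independent[OF e]
  have "e ` {..<k} \<subseteq> span W"
    using e W(3) by (auto simp: orthonormal_family_def)
  then have sub: "insert v (e ` {..<k}) \<subseteq> span W"
    using v W(3) by blast
  have "v \<in> span (e ` {..<k})"
  proof (rule ccontr)
    assume n: "v \<notin> span (e ` {..<k})"
    have "v \<notin> e ` {..<k}"
      by (rule contrapos_nn[OF n]) (rule span_base)
    then have "card (insert v (e ` {..<k})) = Suc (card (e ` {..<k}))"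
      by (rule card_insert_disjoint[rotated]) (rule finite_imageI[OF finite_lessThan])
    then show False
      using independent_span_bound[OF W(1) independent_insertI[OF n i(1)] sub]
      unfolding W(2) i(2) by linarith
  qed
  then show ?thesis using orthonormal_family_expand[OF e] by blast
qed

text \<open>Gram-Schmidt: while k < N, some member of \<open>W\<close> lies outside the span of the
  first k vectors, and its normalised orthogonal remainder is the next vector.\<close>

lemma orthonormal_family_exists:
  assumes W: "independent W" "card W = N" "W \<subseteq> T"
  shows "k \<le> N \<Longrightarrow> \<exists>e. orthonormal_family T g k e"
proof (induction k)
  case 0
  then show ?case by (simp add: orthonormal_family_def)
next
  case (Suc k)
  then obtain e where e: "orthonormal_family T g k e" by auto
  then have eT: "\<And>i. i < k \<Longrightarrow> e i \<in> T" by (auto simp: orthonormal_family_def)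
  have "\<not> W \<subseteq> span (e ` {..<k})"
    using independent_span_bound[OF _ W(1), of "e ` {..<k}"] W(2) Suc.prems
      orthonormal_family_independent(2)[OF e] by auto
  then obtain w where w: "w \<in> T" "w \<notin> span (e ` {..<k})" using W(3) by blast
  define s where "s = (\<Sum>i<k. g w (e i) *\<^sub>R e i)"
  have s: "s \<in> T" "s \<in> span (e ` {..<k})"
    unfolding s_def using eT
    by (auto intro!: subspace_sum[OF T] subspace_scale[OF T] span_sum span_scale intro: span_base)
  define x where "x = w + (- 1) *\<^sub>R s"
  have x: "x \<in> T"
    unfolding x_def by (intro subspace_add[OF T] subspace_scale[OF T] w s)
  have x0: "x \<noteq> 0" using w s by (auto simp: x_def)
  have gx: "g (e j) x = 0" if "j < k" for j
  proof -
    have "g (e j) s = (\<Sum>i<k. g w (e i) * g (e j) (e i))"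
      unfolding s_def by (rule inner_sum[OF eT[OF that]]) (simp add: eT)
    also have "\<dots> = (\<Sum>i<k. if i = j then g w (e i) else 0)"
      using e that by (intro sum.cong) (auto simp: orthonormal_family_def)
    finally have "g (e j) s = g w (e j)" using that by simp
    moreover have "g (e j) x = g (e j) w + (- 1) * g (e j) s"
      unfolding x_def inner_lin(1)[OF eT[OF that] w(1) subspace_scale[OF T s(1)]]
        inner_lin(2)[OF eT[OF that] s(1)] ..
    ultimately show ?thesis using g_sym eT that w(1) by simp
  qed
  have gx': "g x (e j) = 0" if "j < k" for j
    using g_sym[OF x eT[OF that]] gx[OF that] by simp
  define a where "a = 1 / sqrt (g x x)"
  have a: "a * (a * g x x) = 1" using g_pos[OF x x0] by (simp add: a_def)
  define e' where "e' = e(k := a *\<^sub>R x)"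
  have "orthonormal_family T g (Suc k) e'"
    using e x gx gx' a eT
    by (auto simp: orthonormal_family_def e'_def less_Suc_eq inner_lin subspace_scale[OF T])
  then show ?case by blast
qed

end

section \<open>Vector fields\<close>

lemma fmult_const: "fmult (\<lambda>_. c) X = c *\<^sub>R (X :: 'a vfield)"
  by (simp add: fmult_def scaleR_fun_def)

section \<open>The Lie algebra of vector fields\<close>

context
  fixes A :: "('a::{t2_space, second_countable_topology}, 'e::euclidean_space) atlas"
  assumes A: "smooth_manifold A"
begin

lemma tangent_space_subspace: "subspace (tangent_space A p)"
  unfolding subspace_def
  by (auto simp: tangent_space_def scaleR_fun_def algebra_simps)

lemma vector_field_tangent: "X \<in> vector_fields A \<Longrightarrow> X p \<in> tangent_space A p"
  by (simp add: vector_fields_def)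

lemma deriv_along_nonsmooth:
  "X \<in> vector_fields A \<Longrightarrow> \<not> smooth_fun A f \<Longrightarrow> deriv_along X f = (\<lambda>_. 0)"
  by (simp add: fun_eq_iff deriv_along_def tangent_nonsmooth[OF A vector_field_tangent])

text \<open>On a function that is not smooth the result is the zero function. Nested derivatives are
  therefore always smooth, as the bracket computations use.\<close>

lemma smooth_deriv_along:
  assumes X: "X \<in> vector_fields A"
  shows "smooth_fun A (deriv_along X f)"
proof (cases "smooth_fun A f")
  case True
  then show ?thesis using X by (simp add: vector_fields_def)
next
  case False
  then show ?thesis by (simp add: deriv_along_nonsmooth[OF X] smooth_fun_const[OF A])
qed

lemma vector_fields_add: "X \<in> vector_fields A \<Longrightarrow> Y \<in> vector_fields A \<Longrightarrow> X + Y \<in> vector_fields A"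
  using subspace_add[OF tangent_space_subspace] smooth_fun_add[OF A]
  by (auto simp: vector_fields_def deriv_along_def)

lemma vector_fields_fmult: "smooth_fun A u \<Longrightarrow> X \<in> vector_fields A \<Longrightarrow> fmult u X \<in> vector_fields A"
  using subspace_scale[OF tangent_space_subspace] smooth_fun_mult[OF A]
  by (auto simp: vector_fields_def deriv_along_def fmult_def scaleR_fun_def)

lemma vector_fields_scaleR: "X \<in> vector_fields A \<Longrightarrow> c *\<^sub>R X \<in> vector_fields A"
  unfolding fmult_const[symmetric] by (rule vector_fields_fmult[OF smooth_fun_const[OF A]])

lemma vector_fields_0: "0 \<in> vector_fields A"
  by (simp add: vector_fields_def deriv_along_def subspace_0[OF tangent_space_subspace]
      smooth_fun_const[OF A])

lemma vector_fields_uminus: "X \<in> vector_fields A \<Longrightarrow> - X \<in> vector_fields A"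
  using vector_fields_scaleR[of X "- 1"] by simp

lemma vector_fields_diff: "X \<in> vector_fields A \<Longrightarrow> Y \<in> vector_fields A \<Longrightarrow> X - Y \<in> vector_fields A"
  using vector_fields_add[OF _ vector_fields_uminus, of X Y] by simp

lemma vector_fields_sum:
  "(\<And>i. i \<in> I \<Longrightarrow> X i \<in> vector_fields A) \<Longrightarrow> (\<Sum>i\<in>I. X i) \<in> vector_fields A"
  by (induction I rule: infinite_finite_induct) (simp_all add: vector_fields_0 vector_fields_add)

lemma deriv_along_lie_bracket:
  "deriv_along (lie_bracket X Y) f = (\<lambda>p. deriv_along X (deriv_along Y f) p - deriv_along Y (deriv_along X f) p)"
  by (simp add: deriv_along_def lie_bracket_def)

text \<open>The Leibniz rule survives because the cross terms of the two second derivatives are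
  symmetric in \<open>X\<close> and \<open>Y\<close> and cancel.\<close>

lemma vector_fields_lie_bracket:
  assumes X: "X \<in> vector_fields A" and Y: "Y \<in> vector_fields A"
  shows "lie_bracket X Y \<in> vector_fields A"
proof -
  note T = vector_field_tangent
  have lin: "deriv_along Z (\<lambda>q. a * f q + b * h q) = (\<lambda>q. a * deriv_along Z f q + b * deriv_along Z h q)"
    if "Z \<in> vector_fields A" "smooth_fun A f" "smooth_fun A h" for Z f h a b
    using that tangent_lin[OF A T] by (simp add: deriv_along_def)
  have mul: "deriv_along Z (\<lambda>q. f q * h q) = (\<lambda>q. f q * deriv_along Z h q + h q * deriv_along Z f q)"
    if "Z \<in> vector_fields A" "smooth_fun A f" "smooth_fun A h" for Z f h
    using that tangent_mult[OF A T] by (simp add: deriv_along_def)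
  show ?thesis
    unfolding vector_fields_def tangent_space_def mem_Collect_eq deriv_along_lie_bracket
    using X Y
    by (auto simp: lie_bracket_def deriv_along_nonsmooth lin mul
        tangent_const[OF A T[OF X]] tangent_const[OF A T[OF Y]]
        tangent_lin[OF A T[OF X]] tangent_lin[OF A T[OF Y]]
        tangent_add[OF A T[OF X]] tangent_add[OF A T[OF Y]]
        tangent_mult[OF A T[OF X]] tangent_mult[OF A T[OF Y]]
        smooth_fun_mult[OF A] smooth_deriv_along smooth_fun_diff[OF A] algebra_simps)
       (simp add: deriv_along_def)
qed

section \<open>Bases of the tangent spaces\<close>

text \<open>The fields of the local frame are globally defined, so a combination with constant
  coefficients, fitted at \<open>p\<close>, is a global field.\<close>

lemma tangent_vector_extends:
  assumes v: "v \<in> tangent_space A p"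
  obtains X where "X \<in> vector_fields A" "X p = v"
proof -
  obtain \<zeta> :: "'a \<Rightarrow> real" and co :: "'e \<Rightarrow> 'a \<Rightarrow> 'a tvec \<Rightarrow> real" and B :: "'e \<Rightarrow> 'a vfield"
    where z: "\<zeta> p \<noteq> 0" and B: "\<And>b. b \<in> Basis \<Longrightarrow> B b \<in> vector_fields A"
      and e: "\<And>q v. v \<in> tangent_space A q \<Longrightarrow> \<zeta> q *\<^sub>R v = (\<Sum>b\<in>Basis. co b q v *\<^sub>R B b q)"
    by (rule local_frame[OF A, of p]) blast
  let ?X = "\<Sum>b\<in>Basis. (co b p v / \<zeta> p) *\<^sub>R B b"
  have "?X p = (1 / \<zeta> p) *\<^sub>R (\<Sum>b\<in>Basis. co b p v *\<^sub>R B b p)"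
    unfolding scaleR_sum_right by (simp add: sum_fun_apply scaleR_fun_apply)
  also have "\<dots> = v" unfolding e[OF v, symmetric] using z by simp
  finally show ?thesis
    using B that[of ?X] by (metis (no_types, lifting) vector_fields_scaleR vector_fields_sum)
qed

lemma tangent_space_basis:
  obtains W where "finite W" "card W = DIM('e)" "independent W" "W \<subseteq> tangent_space A p"
    "tangent_space A p \<subseteq> span W"
proof -
  obtain \<zeta> :: "'a \<Rightarrow> real" and co :: "'e \<Rightarrow> 'a \<Rightarrow> 'a tvec \<Rightarrow> real" and B :: "'e \<Rightarrow> 'a vfield"
    where z: "\<zeta> p \<noteq> 0" and B: "\<And>b. b \<in> Basis \<Longrightarrow> B b \<in> vector_fields A"
      and e: "\<And>q v. v \<in> tangent_space A q \<Longrightarrow> \<zeta> q *\<^sub>R v = (\<Sum>b\<in>Basis. co b q v *\<^sub>R B b q)"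
      and dual: "\<And>b b'. b \<in> Basis \<Longrightarrow> b' \<in> Basis \<Longrightarrow> co b p (B b' p) = (if b = b' then \<zeta> p else 0)"
      and lin: "\<And>b q. lin_on UNIV (co b q)"
    by (rule local_frame[OF A, of p]) blast
  let ?W = "(\<lambda>b. B b p) ` Basis"
  have inj: "inj_on (\<lambda>b. B b p) Basis"
    using dual z by (intro inj_onI) metis
  have sub: "subspace {x. co b p x = 0}" for b
  proof -
    have "linear (co b p)" using lin by (rule lin_on_UNIV)
    then show ?thesis by (auto simp: subspace_def linear_0 linear_add linear_cmul)
  qed
  have "independent ?W"
    unfolding dependent_def
  proof safe
    fix b :: 'e assume b: "b \<in> Basis" and s: "B b p \<in> span (?W - {B b p})"
    have "co b p (B b p) = 0"
      by (rule span_induct[OF s sub]) (use dual b in auto)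
    then show False using dual b z by simp
  qed
  moreover have "v \<in> span ?W" if "v \<in> tangent_space A p" for v
  proof -
    have "(\<Sum>b\<in>Basis. co b p v *\<^sub>R B b p) \<in> span ?W"
      by (intro span_sum span_scale span_base imageI)
    then have "(1 / \<zeta> p) *\<^sub>R (\<zeta> p *\<^sub>R v) \<in> span ?W" unfolding e[OF that] by (rule span_scale)
    then show ?thesis using z by simp
  qed
  ultimately show ?thesis
    using that[of ?W] B vector_field_tangent inj by (auto simp: card_image)
qed

text \<open>\<open>ricci\<close> picks its basis by Hilbert choice, so its value can be computed
  only once such a basis is known to exist.\<close>

lemma orthonormal_at_exists:
  assumes g: "riemannian_metric A g"
  shows "\<exists>E. orthonormal_at A g p E"
proof -
  have g': "\<And>v. v \<in> tangent_space A p \<Longrightarrow> lin_on (tangent_space A p) (g p v)"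
    "\<And>v w. v \<in> tangent_space A p \<Longrightarrow> w \<in> tangent_space A p \<Longrightarrow> g p v w = g p w v"
    "\<And>v. v \<in> tangent_space A p \<Longrightarrow> v \<noteq> 0 \<Longrightarrow> g p v v > 0"
    using g unfolding riemannian_metric_def by blast+
  obtain W where W: "finite W" "card W = DIM('e)" "independent W" "W \<subseteq> tangent_space A p"
    "tangent_space A p \<subseteq> span W"
    by (rule tangent_space_basis)
  obtain e where "orthonormal_family (tangent_space A p) (g p) DIM('e) e"
    using orthonormal_family_exists[OF tangent_space_subspace g' W(3,2,4) order_refl] by blast
  then have e: "\<And>i. i < DIM('e) \<Longrightarrow> e i \<in> tangent_space A p"
    "\<And>i j. i < DIM('e) \<Longrightarrow> j < DIM('e) \<Longrightarrow> g p (e i) (e j) = (if i = j then 1 else 0)"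
    by (simp_all add: orthonormal_family_def)
  have "\<exists>X. X \<in> vector_fields A \<and> X p = e i" if "i < DIM('e)" for i
    using tangent_vector_extends[OF e(1)[OF that]] by metis
  then obtain E where "\<And>i. i < DIM('e) \<Longrightarrow> E i \<in> vector_fields A \<and> E i p = e i" by metis
  then have "orthonormal_at A g p E" using e unfolding orthonormal_at_def by simp
  then show ?thesis by blast
qed

lemma orthonormal_at_expand:
  fixes E :: "nat \<Rightarrow> 'a vfield"
  assumes g: "riemannian_metric A g" and E: "orthonormal_at A g p E" and v: "v \<in> tangent_space A p"
  shows "v = (\<Sum>i<DIM('e). g p v (E i p) *\<^sub>R E i p)"
proof -
  have g': "\<And>v. v \<in> tangent_space A p \<Longrightarrow> lin_on (tangent_space A p) (g p v)"
    "\<And>v w. v \<in> tangent_space A p \<Longrightarrow> w \<in> tangent_space A p \<Longrightarrow> g p v w = g p w v"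
    "\<And>v. v \<in> tangent_space A p \<Longrightarrow> v \<noteq> 0 \<Longrightarrow> g p v v > 0"
    using g unfolding riemannian_metric_def by blast+
  obtain W where W: "finite W" "card W = DIM('e)" "independent W" "W \<subseteq> tangent_space A p"
    "tangent_space A p \<subseteq> span W"
    by (rule tangent_space_basis)
  have "orthonormal_family (tangent_space A p) (g p) (DIM('e)) (\<lambda>i. E i p)"
    using E vector_field_tangent
    unfolding orthonormal_family_def orthonormal_at_def by auto
  from orthonormal_family_spans[OF tangent_space_subspace g' this W(1,2,5) v] show ?thesis .
qed

end

section \<open>The Levi-Civita connection\<close>

locale riemannian =
  fixes A :: "('a::{t2_space, second_countable_topology}, 'e::euclidean_space) atlas"
    and g :: "'a bilin" and D :: "'a connection"
  assumes mfd: "smooth_manifold A" and metric: "riemannian_metric A g" and lc: "levi_civita A g D"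
begin

abbreviation "VF \<equiv> vector_fields A"
abbreviation "G \<equiv> app2 g"

lemmas vf [simp] = vector_fields_add[OF mfd] vector_fields_fmult[OF mfd] vector_fields_scaleR[OF mfd]
  vector_fields_0[OF mfd] vector_fields_uminus[OF mfd] vector_fields_diff[OF mfd]
  vector_fields_lie_bracket[OF mfd]

lemma D_vf [simp]: "X \<in> VF \<Longrightarrow> Y \<in> VF \<Longrightarrow> D X Y \<in> VF"
  using lc by (simp add: levi_civita_def)

lemma smooth_G [simp]: "X \<in> VF \<Longrightarrow> Y \<in> VF \<Longrightarrow> smooth_fun A (G X Y)"
  using metric by (simp add: riemannian_metric_def)

lemmas smooth_const [simp] = smooth_fun_const[OF mfd]
lemmas smooth_deriv [simp] = smooth_deriv_along[OF mfd]

lemma metric_at: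
  "v \<in> tangent_space A p \<Longrightarrow> lin_on (tangent_space A p) (g p v)"
  "v \<in> tangent_space A p \<Longrightarrow> w \<in> tangent_space A p \<Longrightarrow> g p v w = g p w v"
  "v \<in> tangent_space A p \<Longrightarrow> v \<noteq> 0 \<Longrightarrow> g p v v > 0"
  using metric unfolding riemannian_metric_def by blast+

lemmas inner_at = inner_lin[OF tangent_space_subspace[OF mfd] metric_at]

lemmas tangent [simp] = vector_field_tangent[OF mfd]

lemma G_sym: "X \<in> VF \<Longrightarrow> Y \<in> VF \<Longrightarrow> G X Y p = G Y X p"
  by (simp add: app2_def metric_at(2))

lemma G_left [simp]:
  "X \<in> VF \<Longrightarrow> Y \<in> VF \<Longrightarrow> Z \<in> VF \<Longrightarrow> G (X + Y) Z p = G X Z p + G Y Z p"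
  "X \<in> VF \<Longrightarrow> Z \<in> VF \<Longrightarrow> G (fmult u X) Z p = u p * G X Z p"
  "X \<in> VF \<Longrightarrow> Z \<in> VF \<Longrightarrow> G (c *\<^sub>R X) Z p = c * G X Z p"
  "Z \<in> VF \<Longrightarrow> G 0 Z p = 0"
  by (simp_all add: app2_def fmult_def scaleR_fun_apply inner_at)

lemma G_left' [simp]:
  "X \<in> VF \<Longrightarrow> Z \<in> VF \<Longrightarrow> G (- X) Z p = - G X Z p"
  "X \<in> VF \<Longrightarrow> Y \<in> VF \<Longrightarrow> Z \<in> VF \<Longrightarrow> G (X - Y) Z p = G X Z p - G Y Z p"
proof -
  show m: "G (- X) Z p = - G X Z p" if "X \<in> VF" "Z \<in> VF" for X
    using G_left(3)[OF that, of "- 1" p] by (simp del: G_left)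
  show "G (X - Y) Z p = G X Z p - G Y Z p" if "X \<in> VF" "Y \<in> VF" "Z \<in> VF"
    using G_left(1)[of X "- Y" Z p] m[of Y] that by (simp del: G_left)
qed

lemma G_0_right [simp]: "Z \<in> VF \<Longrightarrow> G Z 0 p = 0"
  by (simp add: G_sym[of Z])

lemma G_right [simp]:
  assumes "Z \<in> VF" "X \<in> VF"
  shows "Y \<in> VF \<Longrightarrow> G Z (X + Y) p = G Z X p + G Z Y p"
    "smooth_fun A u \<Longrightarrow> G Z (fmult u X) p = u p * G Z X p"
    "G Z (c *\<^sub>R X) p = c * G Z X p"
    "G Z (- X) p = - G Z X p"
    "Y \<in> VF \<Longrightarrow> G Z (X - Y) p = G Z X p - G Z Y p"
  using assms by (simp_all add: G_sym[of Z])

lemma G_pos: "X \<in> VF \<Longrightarrow> X p \<noteq> 0 \<Longrightarrow> G X X p > 0"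
  by (simp add: app2_def metric_at(3))

lemma field_eq_0I: "X \<in> VF \<Longrightarrow> (\<And>p. G X X p = 0) \<Longrightarrow> X = 0"
  using G_pos by (intro ext[of X 0]) (metis less_irrefl zero_fun_apply)

lemma field_eqI:
  assumes X: "X \<in> VF" and Y: "Y \<in> VF" and eq: "\<And>Z p. Z \<in> VF \<Longrightarrow> G X Z p = G Y Z p"
  shows "X = Y"
proof -
  have "G (X - Y) (X - Y) p = 0" for p
    using eq[of "X - Y" p] X Y G_left'(2)[of X Y "X - Y" p] by (simp del: G_left' G_right)
  then have "X - Y = 0" by (rule field_eq_0I[rotated]) (simp add: X Y)
  then show ?thesis by simp
qed

lemma D_add:
  "X \<in> VF \<Longrightarrow> Y \<in> VF \<Longrightarrow> Z \<in> VF \<Longrightarrow> D (X + Y) Z = D X Z + D Y Z"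
  "X \<in> VF \<Longrightarrow> Y \<in> VF \<Longrightarrow> Z \<in> VF \<Longrightarrow> D X (Y + Z) = D X Y + D X Z"
  using lc unfolding levi_civita_def by blast+

lemma D_fmult:
  "X \<in> VF \<Longrightarrow> Y \<in> VF \<Longrightarrow> smooth_fun A u \<Longrightarrow> D (fmult u X) Y = fmult u (D X Y)"
  "X \<in> VF \<Longrightarrow> Y \<in> VF \<Longrightarrow> smooth_fun A u \<Longrightarrow>
    D X (fmult u Y) = fmult (deriv_along X u) Y + fmult u (D X Y)"
  using lc unfolding levi_civita_def by blast+

lemma torsion:
  assumes "X \<in> VF" "Y \<in> VF"
  shows "lie_bracket X Y = D X Y - D Y X"
proof -
  have "D X Y - D Y X = lie_bracket X Y"
    using lc assms unfolding levi_civita_def by blast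
  then show ?thesis by (rule sym)
qed

lemma compat:
  assumes "X \<in> VF" "Y \<in> VF" "Z \<in> VF"
  shows "deriv_along X (G Y Z) p = G (D X Y) Z p + G Y (D X Z) p"
proof -
  have "deriv_along X (G Y Z) = G (D X Y) Z + G Y (D X Z)"
    using lc assms unfolding levi_civita_def by blast
  then show ?thesis by simp
qed

lemma deriv_const [simp]: "X \<in> VF \<Longrightarrow> deriv_along X (\<lambda>_. c) p = 0"
  by (simp add: deriv_along_def tangent_const[OF mfd tangent])

lemma deriv_add: "X \<in> VF \<Longrightarrow> smooth_fun A u \<Longrightarrow> smooth_fun A v \<Longrightarrow>
    deriv_along X (\<lambda>q. u q + v q) p = deriv_along X u p + deriv_along X v p"
  by (simp add: deriv_along_def tangent_add[OF mfd tangent])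

lemma deriv_uminus: "X \<in> VF \<Longrightarrow> smooth_fun A u \<Longrightarrow>
    deriv_along X (\<lambda>q. - u q) p = - deriv_along X u p"
  using tangent_cmult[OF mfd tangent, of X u p "- 1"] by (simp add: deriv_along_def)

lemma fmult_0 [simp]: "fmult (\<lambda>_. 0) X = (0 :: 'a vfield)" "fmult u 0 = (0 :: 'a vfield)"
  by (simp add: fmult_const) (simp add: fmult_def zero_fun_def scaleR_fun_def)

lemma D_left [simp]:
  assumes "X \<in> VF" "Z \<in> VF"
  shows "Y \<in> VF \<Longrightarrow> D (X + Y) Z = D X Z + D Y Z"
    "smooth_fun A u \<Longrightarrow> D (fmult u X) Z = fmult u (D X Z)"
    "D (c *\<^sub>R X) Z = c *\<^sub>R D X Z"
    "D (- X) Z = - D X Z"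
    "Y \<in> VF \<Longrightarrow> D (X - Y) Z = D X Z - D Y Z"
proof -
  have s: "D (c *\<^sub>R X) Z = c *\<^sub>R D X Z" if "X \<in> VF" for c X
    using D_fmult(1)[OF that assms(2) smooth_const[of c]] by (simp add: fmult_const)
  have m: "D (- X) Z = - D X Z" if "X \<in> VF" for X
    using s[OF that, of "- 1"] by simp
  show "D (X - Y) Z = D X Z - D Y Z" if "Y \<in> VF"
    using D_add(1)[of X "- Y" Z] m[OF that] assms that by simp
  show "D (c *\<^sub>R X) Z = c *\<^sub>R D X Z" "D (- X) Z = - D X Z" using s m assms by blast+
qed (use assms D_add D_fmult in auto)

lemma D_right [simp]:
  assumes "X \<in> VF" "Y \<in> VF"
  shows "Z \<in> VF \<Longrightarrow> D X (Y + Z) = D X Y + D X Z"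
    "D X (c *\<^sub>R Y) = c *\<^sub>R D X Y"
    "D X (- Y) = - D X Y"
    "Z \<in> VF \<Longrightarrow> D X (Y - Z) = D X Y - D X Z"
proof -
  have "deriv_along X (\<lambda>_. c) = (\<lambda>_. 0)" for c using assms by (simp add: fun_eq_iff)
  then have s: "D X (c *\<^sub>R Y) = c *\<^sub>R D X Y" if "Y \<in> VF" for c Y
    using D_fmult(2)[OF assms(1) that smooth_const[of c]] by (simp add: fmult_const)
  have m: "D X (- Y) = - D X Y" if "Y \<in> VF" for Y
    using s[OF that, of "- 1"] by simp
  show "D X (Y - Z) = D X Y - D X Z" if "Z \<in> VF"
    using D_add(2)[of X Y "- Z"] m[OF that] assms that by simp
  show "D X (c *\<^sub>R Y) = c *\<^sub>R D X Y" "D X (- Y) = - D X Y" using s m assms by blast+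
qed (use assms D_add in auto)

lemma D_0 [simp]: "X \<in> VF \<Longrightarrow> D X 0 = 0" "X \<in> VF \<Longrightarrow> D 0 X = 0"
  using D_right(2)[of X 0 0] D_left(3)[of 0 X 0] by simp_all

section \<open>Jacobi identity, curvature and traces\<close>

lemma lie_bracket_jacobi:
  assumes "X \<in> VF" "Y \<in> VF" "Z \<in> VF"
  shows "lie_bracket X (lie_bracket Y Z) + lie_bracket Y (lie_bracket Z X)
    + lie_bracket Z (lie_bracket X Y) = 0"
proof (intro ext)
  fix p f
  have "W p (\<lambda>q. deriv_along U h q - deriv_along V k q) = W p (deriv_along U h) - W p (deriv_along V k)"
    if "W \<in> VF" "U \<in> VF" "V \<in> VF" for W U V h k
    using tangent_diff[OF mfd tangent[OF that(1)], of "deriv_along U h" "deriv_along V k"] that by simp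
  note d = this[OF assms(1)] this[OF assms(2)] this[OF assms(3)]
  show "(lie_bracket X (lie_bracket Y Z) + lie_bracket Y (lie_bracket Z X)
    + lie_bracket Z (lie_bracket X Y)) p f = 0 p f"
    using assms
    by (simp add: lie_bracket_def[of X "lie_bracket Y Z"] lie_bracket_def[of Y "lie_bracket Z X"]
        lie_bracket_def[of Z "lie_bracket X Y"] deriv_along_lie_bracket[OF mfd] d)
      (simp add: lie_bracket_def)
qed

text \<open>Expand [X, Y] = XY - YX on the function g(Z, W) by metric compatibility; the mixed terms
  cancel. \<open>N\<close>, \<open>L\<close> and \<open>M\<close> are left open so that the lemma
  serves both \<open>D\<close> on all fields and the leaf connection on the fields tangent to ker
  \<eta>.\<close>

lemma curvature_skew:
  assumes L: "L \<subseteq> VF" "\<And>X Y. X \<in> L \<Longrightarrow> Y \<in> L \<Longrightarrow> lie_bracket X Y \<in> L"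
    and M: "M \<subseteq> VF" "\<And>X Y. X \<in> L \<Longrightarrow> Y \<in> M \<Longrightarrow> N X Y \<in> M"
    and c: "\<And>X Y Z p. X \<in> L \<Longrightarrow> Y \<in> M \<Longrightarrow> Z \<in> M \<Longrightarrow>
      deriv_along X (G Y Z) p = G (N X Y) Z p + G Y (N X Z) p"
    and m: "X \<in> L" "Y \<in> L" "Z \<in> M" "W \<in> M"
  shows "G (curvature N X Y Z) W p = - G (curvature N X Y W) Z p"
proof -
  have v: "U \<in> VF" if "U \<in> L \<or> U \<in> M" for U using that L M by blast
  have dd: "deriv_along U (deriv_along V (G Z W)) p = G (N U (N V Z)) W p + G (N V Z) (N U W) p
      + G (N U Z) (N V W) p + G Z (N U (N V W)) p" if "U \<in> L" "V \<in> L" for U V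
  proof -
    have "deriv_along V (G Z W) = (\<lambda>q. G (N V Z) W q + G Z (N V W) q)"
      using c[OF that(2) m(3,4)] by (rule ext)
    then show ?thesis using that m v M(2) c by (simp add: deriv_add)
  qed
  have "deriv_along (lie_bracket X Y) (G Z W) p
      = deriv_along X (deriv_along Y (G Z W)) p - deriv_along Y (deriv_along X (G Z W)) p"
    by (simp add: deriv_along_lie_bracket[OF mfd])
  then have "G (N (lie_bracket X Y) Z) W p + G Z (N (lie_bracket X Y) W) p
      = (G (N X (N Y Z)) W p + G Z (N X (N Y W)) p) - (G (N Y (N X Z)) W p + G Z (N Y (N X W)) p)"
    using dd[OF m(1,2)] dd[OF m(2,1)] c[OF L(2)[OF m(1,2)] m(3,4)] by simp
  then show ?thesis
    unfolding curvature_def using m v M(2) L(2)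
    by (simp add: G_sym[of _ Z])
qed

lemma curvature_skew_D: "X \<in> VF \<Longrightarrow> Y \<in> VF \<Longrightarrow> Z \<in> VF \<Longrightarrow> W \<in> VF \<Longrightarrow>
    G (curvature D X Y Z) W p = - G (curvature D X Y W) Z p"
  by (rule curvature_skew[of VF VF]) (simp_all add: compat)

lemma curvature_vf [simp]: "X \<in> VF \<Longrightarrow> Y \<in> VF \<Longrightarrow> Z \<in> VF \<Longrightarrow> curvature D X Y Z \<in> VF"
  by (simp add: curvature_def)

lemma fmult_simps:
  "fmult u (X + Y) = fmult u X + fmult u Y" "fmult u (X - Y) = fmult u X - fmult u Y"
  for X Y :: "'a vfield"
  by (auto simp: fmult_def scaleR_add_right scaleR_diff_right)

lemma curvature_left:
  assumes "X \<in> VF" "Y \<in> VF" "Z \<in> VF"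
  shows "X' \<in> VF \<Longrightarrow> curvature D (X + X') Y Z = curvature D X Y Z + curvature D X' Y Z"
    and "smooth_fun A u \<Longrightarrow> curvature D (fmult u X) Y Z = fmult u (curvature D X Y Z)"
  using assms by (simp_all add: curvature_def torsion D_fmult(2) fmult_simps)

lemma curvature_antisym:
  "X \<in> VF \<Longrightarrow> Y \<in> VF \<Longrightarrow> Z \<in> VF \<Longrightarrow> curvature D X Y Z = - curvature D Y X Z"
  by (simp add: curvature_def torsion)

text \<open>Sums over an orthonormal basis are evaluated by this identity, in place of the
  invariance of traces under a change of basis.\<close>

lemma parseval:
  assumes E: "orthonormal_at A g p E" and X: "X \<in> VF" and Y: "Y \<in> VF"
  shows "(\<Sum>i<DIM('e). G X (E i) p * G Y (E i) p) = G X Y p"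
proof -
  have EV: "i < DIM('e) \<Longrightarrow> E i \<in> VF" for i using E by (simp add: orthonormal_at_def)
  have "G Y X p = g p (Y p) (\<Sum>i<DIM('e). g p (X p) (E i p) *\<^sub>R E i p)"
    unfolding app2_def
    using orthonormal_at_expand[OF mfd metric E tangent[OF X]] by simp
  also have "\<dots> = (\<Sum>i<DIM('e). g p (X p) (E i p) * g p (Y p) (E i p))"
    by (rule inner_sum[OF tangent_space_subspace[OF mfd] metric_at tangent[OF Y]]) (simp_all add: EV)
  finally show ?thesis using G_sym[OF X Y] by (simp add: app2_def)
qed

text \<open>The basis chosen in \<open>ricci\<close> depends on \<open>p\<close> alone, so one
  \<open>E\<close> serves all \<open>Y\<close> and \<open>Z\<close>.\<close>

lemma ricci_eq_sum:
  obtains E where "orthonormal_at A g p E"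
    "\<And>Y Z. ricci A g D Y Z p = (\<Sum>i<DIM('e). G (curvature D (E i) Y Z) (E i) p)"
proof
  let ?E = "SOME E. orthonormal_at A g p E"
  show "orthonormal_at A g p ?E"
    using someI_ex[OF orthonormal_at_exists[OF mfd metric]] .
  show "ricci A g D Y Z p = (\<Sum>i<DIM('e). G (curvature D (?E i) Y Z) (?E i) p)" for Y Z
    by (simp add: ricci_def Let_def app2_def)
qed

end

section \<open>Almost cosymplectic manifolds\<close>

locale almost_cosymplectic_manifold = riemannian A g D
  for A :: "('a::{t2_space, second_countable_topology}, 'e::euclidean_space) atlas"
    and g :: "'a bilin" and D :: "'a connection" +
  fixes \<phi> :: "'a tensor11" and \<xi> :: "'a vfield" and \<eta> :: "'a form1"
  assumes ac: "almost_cosymplectic A \<phi> \<xi> \<eta> g"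
begin

abbreviation \<Phi> :: "'a vfield \<Rightarrow> 'a vfield" where "\<Phi> \<equiv> app11 \<phi>"
abbreviation S :: "'a vfield \<Rightarrow> 'a vfield" where "S X \<equiv> D X \<xi>"
abbreviation "e \<equiv> app1 \<eta>"

lemma acm: "almost_contact_metric A \<phi> \<xi> \<eta> g" "closed1 A \<eta>" "closed2 A (fundamental_form \<phi> g)"
  using ac by (simp_all add: almost_cosymplectic_def)

lemma \<xi>_vf [simp]: "\<xi> \<in> VF" and \<Phi>_vf [simp]: "X \<in> VF \<Longrightarrow> \<Phi> X \<in> VF"
  and smooth_e [simp]: "X \<in> VF \<Longrightarrow> smooth_fun A (e X)"
  using acm(1) by (simp_all add: almost_contact_metric_def tensor_field11_def one_form_def)

lemma lin_\<phi>: "lin_on (tangent_space A p) (\<phi> p)"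
  using acm(1) by (simp add: almost_contact_metric_def tensor_field11_def)

lemma \<Phi>_lin [simp]:
  "X \<in> VF \<Longrightarrow> Y \<in> VF \<Longrightarrow> \<Phi> (X + Y) = \<Phi> X + \<Phi> Y"
  "X \<in> VF \<Longrightarrow> \<Phi> (fmult u X) = fmult u (\<Phi> X)"
  "X \<in> VF \<Longrightarrow> \<Phi> (c *\<^sub>R X) = c *\<^sub>R \<Phi> X"
  by (rule ext, simp add: app11_def fmult_def scaleR_fun_apply lin_onD(1)[OF lin_\<phi> tangent tangent]
      lin_onD(2)[OF lin_\<phi> tangent])+

lemma \<Phi>_uminus [simp]: "X \<in> VF \<Longrightarrow> \<Phi> (- X) = - \<Phi> X"
  using \<Phi>_lin(3)[of X "- 1"] by simp

lemma \<Phi>_diff [simp]: "X \<in> VF \<Longrightarrow> Y \<in> VF \<Longrightarrow> \<Phi> (X - Y) = \<Phi> X - \<Phi> Y"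
  using \<Phi>_lin(1)[of X "- Y"] by simp

lemma \<Phi>_0 [simp]: "\<Phi> 0 = 0"
  using \<Phi>_lin(3)[of 0 0] by simp

lemma G_\<xi> [simp]: "X \<in> VF \<Longrightarrow> G X \<xi> p = e X p" "X \<in> VF \<Longrightarrow> G \<xi> X p = e X p"
proof -
  show *: "G X \<xi> p = e X p" if "X \<in> VF"
    using acm(1) tangent[OF that] by (simp add: almost_contact_metric_def app2_def app1_def)
  then show "G \<xi> X p = e X p" if "X \<in> VF" using that by (simp add: G_sym[of \<xi>])
qed

lemma e_eq: "X \<in> VF \<Longrightarrow> e X = G X \<xi>"
  by (simp add: fun_eq_iff)

lemma e_lin [simp]:
  "X \<in> VF \<Longrightarrow> Y \<in> VF \<Longrightarrow> e (X + Y) p = e X p + e Y p"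
  "X \<in> VF \<Longrightarrow> Y \<in> VF \<Longrightarrow> e (X - Y) p = e X p - e Y p"
  "X \<in> VF \<Longrightarrow> e (- X) p = - e X p"
  "X \<in> VF \<Longrightarrow> smooth_fun A u \<Longrightarrow> e (fmult u X) p = u p * e X p"
  "X \<in> VF \<Longrightarrow> e (c *\<^sub>R X) p = c * e X p"
  "e 0 p = 0" "e \<xi> p = 1"
  using acm(1) by (simp_all add: e_eq almost_contact_metric_def del: G_\<xi>)
     (simp add: app1_def G_\<xi>)

lemma \<Phi>_contact [simp]:
  "X \<in> VF \<Longrightarrow> \<Phi> (\<Phi> X) = fmult (e X) \<xi> - X"
  "X \<in> VF \<Longrightarrow> e (\<Phi> X) p = 0"
  "\<Phi> \<xi> = 0"
proof -
  show "\<Phi> (\<Phi> X) = fmult (e X) \<xi> - X" if "X \<in> VF"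
    by (rule ext) (use acm(1) tangent[OF that] in
        \<open>simp add: almost_contact_metric_def app11_def app1_def fmult_def fun_diff_def\<close>)
  show "e (\<Phi> X) p = 0" if "X \<in> VF"
    using acm(1) tangent[OF that] by (simp add: almost_contact_metric_def app11_def app1_def)
  show "\<Phi> \<xi> = 0"
    by (rule ext) (use acm(1) in \<open>simp add: almost_contact_metric_def app11_def zero_fun_def\<close>)
qed

lemma G_\<Phi>_\<Phi>: "X \<in> VF \<Longrightarrow> Y \<in> VF \<Longrightarrow> G (\<Phi> X) (\<Phi> Y) p = G X Y p - e X p * e Y p"
  using acm(1) tangent[of X] tangent[of Y]
  by (simp add: almost_contact_metric_def app11_def app1_def app2_def)

lemma \<Phi>_skew: "X \<in> VF \<Longrightarrow> Y \<in> VF \<Longrightarrow> G (\<Phi> X) Y p = - G X (\<Phi> Y) p"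
  using G_\<Phi>_\<Phi>[of X "\<Phi> Y" p] by simp

text \<open>Differentiate g(\<xi>, \<xi>) = 1.\<close>

lemma e_S [simp]: "X \<in> VF \<Longrightarrow> e (S X) p = 0"
proof -
  assume X: "X \<in> VF"
  have "G \<xi> \<xi> = (\<lambda>_. 1)" by (simp add: fun_eq_iff)
  then show ?thesis using compat[OF X \<xi>_vf \<xi>_vf, of p] X by simp
qed

lemma deriv_e: "X \<in> VF \<Longrightarrow> Y \<in> VF \<Longrightarrow> deriv_along X (e Y) p = e (D X Y) p + G Y (S X) p"
  using compat[of X Y \<xi>] by (simp add: e_eq[of Y])

text \<open>As the torsion is zero, d\<eta>(X, Y) = g(S X, Y) - g(S Y, X).\<close>

lemma S_sym: "X \<in> VF \<Longrightarrow> Y \<in> VF \<Longrightarrow> G (S X) Y p = G X (S Y) p"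
proof -
  assume X: "X \<in> VF" and Y: "Y \<in> VF"
  have "(deriv_along X (e Y) - deriv_along Y (e X) - e (lie_bracket X Y)) p = 0"
    using acm(2) X Y unfolding closed1_def by (metis zero_fun_apply)
  then show ?thesis using X Y by (simp add: torsion deriv_e G_sym[of "S X"])
qed

text \<open>By symmetry g(S \<xi>, Z) = \<eta>(S Z) = 0; the integral curves of \<xi> are
  geodesics.\<close>

lemma S_\<xi> [simp]: "S \<xi> = 0"
  by (rule field_eqI) (simp_all add: S_sym)

section \<open>The covariant derivative of \<phi>\<close>

definition d\<Phi> :: "'a connection" where "d\<Phi> X Y = D X (\<Phi> Y) - \<Phi> (D X Y)"

lemma d\<Phi>_vf [simp]: "X \<in> VF \<Longrightarrow> Y \<in> VF \<Longrightarrow> d\<Phi> X Y \<in> VF"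
  by (simp add: d\<Phi>_def)

lemma d\<Phi>_skew: "X \<in> VF \<Longrightarrow> Y \<in> VF \<Longrightarrow> Z \<in> VF \<Longrightarrow> G (d\<Phi> X Y) Z p = - G (d\<Phi> X Z) Y p"
proof -
  assume v: "X \<in> VF" "Y \<in> VF" "Z \<in> VF"
  have "G (\<Phi> Y) Z = (\<lambda>q. - G (\<Phi> Z) Y q)"
    using v by (simp add: fun_eq_iff \<Phi>_skew[of Y] G_sym[of Y])
  then have "deriv_along X (G (\<Phi> Y) Z) p = - deriv_along X (G (\<Phi> Z) Y) p"
    using v by (simp add: deriv_uminus)
  then show ?thesis
    using v by (simp add: compat d\<Phi>_def \<Phi>_skew[of "D X _"] \<Phi>_skew[of Y] \<Phi>_skew[of Z] G_sym[of _ "D X _"] G_sym[of Y] G_sym[of Z])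
qed

text \<open>The derivative of the identity \<phi>^2 = -I + \<eta> \<otimes> \<xi>.\<close>

lemma d\<Phi>_square:
  assumes v: "X \<in> VF" "Y \<in> VF"
  shows "d\<Phi> X (\<Phi> Y) + \<Phi> (d\<Phi> X Y) = fmult (G Y (S X)) \<xi> + fmult (e Y) (S X)"
proof -
  have "deriv_along X (e Y) = (\<lambda>q. e (D X Y) q + G Y (S X) q)"
    using v by (simp add: fun_eq_iff deriv_e)
  then show ?thesis
    using v by (simp add: d\<Phi>_def D_fmult(2)) (simp add: fmult_def fun_eq_iff scaleR_fun_apply algebra_simps)
qed

text \<open>For a torsion-free metric connection this cyclic sum is d\<omega>(X, Y, Z).\<close>

lemma d\<Phi>_cyclic:
  assumes v: "X \<in> VF" "Y \<in> VF" "Z \<in> VF"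
  shows "G (d\<Phi> X Y) Z p + G (d\<Phi> Y Z) X p + G (d\<Phi> Z X) Y p = 0"
proof -
  let ?\<omega> = "fundamental_form \<phi> g"
  have \<omega>: "app2 ?\<omega> U V = G (\<Phi> U) V" for U V
    by (simp add: fun_eq_iff app2_def fundamental_form_def app11_def)
  have "(deriv_along X (app2 ?\<omega> Y Z) + deriv_along Y (app2 ?\<omega> Z X) + deriv_along Z (app2 ?\<omega> X Y)
       - app2 ?\<omega> (lie_bracket X Y) Z - app2 ?\<omega> (lie_bracket Y Z) X - app2 ?\<omega> (lie_bracket Z X) Y) p = 0"
    using acm(3) v unfolding closed2_def by (metis zero_fun_apply)
  then show ?thesis
    using v by (simp add: \<omega> compat torsion d\<Phi>_def \<Phi>_skew[of X] \<Phi>_skew[of Y] \<Phi>_skew[of Z]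
        G_sym[of X] G_sym[of Y] G_sym[of Z])
qed

text \<open>In the cyclic identity for \<xi>, Y, Z the two other terms are known by differentiating
  \<phi> \<xi> = 0 and \<eta>(\<phi> Z) = 0.\<close>

lemma d\<Phi>_\<xi>:
  assumes Y: "Y \<in> VF"
  shows "d\<Phi> \<xi> Y = - (\<Phi> (S Y) + S (\<Phi> Y))"
proof (rule field_eqI)
  fix Z p assume Z: "Z \<in> VF"
  have "e (d\<Phi> Y Z) p = - G (\<Phi> Z) (S Y) p"
  proof -
    have "e (\<Phi> Z) = (\<lambda>_. 0)" using Z by (simp add: fun_eq_iff)
    then show ?thesis using deriv_e[of Y "\<Phi> Z" p] Y Z by (simp add: d\<Phi>_def)
  qed
  moreover have "d\<Phi> Z \<xi> = - \<Phi> (S Z)" using Z by (simp add: d\<Phi>_def)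
  ultimately show "G (d\<Phi> \<xi> Y) Z p = G (- (\<Phi> (S Y) + S (\<Phi> Y))) Z p"
    using d\<Phi>_cyclic[of \<xi> Y Z p] Y Z
    by (simp add: \<Phi>_skew[of "S _"] \<Phi>_skew[of Z] G_sym[of Z] S_sym[of _ "\<Phi> _"] S_sym[of "\<Phi> _"])
qed (simp_all add: Y)

text \<open>Put B = \<phi> S + S \<phi>, which commutes with \<phi>. Since -B is the derivative of
  \<phi> along \<xi>, differentiating \<phi>^2 along \<xi> shows that B also anticommutes with
  \<phi>. Hence \<phi> B = 0, and B takes values in ker \<eta>, where \<phi> is injective.\<close>

lemma S_\<Phi>: 
  assumes Y: "Y \<in> VF"
  shows "S (\<Phi> Y) = - \<Phi> (S Y)"
proof -
  let ?B = "\<lambda>Y. \<Phi> (S Y) + S (\<Phi> Y)"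
  have eS: "e (S Y) = (\<lambda>_. 0)" and es: "G Y 0 = (\<lambda>_. 0)" using Y by (simp_all add: fun_eq_iff)
  have B: "?B (\<Phi> Y) = \<Phi> (?B Y)"
    using Y by (simp add: eS)
  have "- ?B (\<Phi> Y) - \<Phi> (?B Y) = d\<Phi> \<xi> (\<Phi> Y) + \<Phi> (d\<Phi> \<xi> Y)"
    using Y by (simp add: d\<Phi>_\<xi>)
  also have "\<dots> = 0" using d\<Phi>_square[of \<xi> Y] Y by (simp add: es)
  finally have "(- 2) *\<^sub>R \<Phi> (?B Y) = 0" unfolding B by (simp only: scaleR_minus_left scaleR_2) simp
  then have "\<Phi> (?B Y) = 0" by (simp only: scaleR_eq_0_iff) simp
  then have "\<Phi> (\<Phi> (?B Y)) = 0" by simp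
  moreover have "e (?B Y) = (\<lambda>_. 0)" using Y by (simp add: fun_eq_iff)
  moreover have "\<Phi> (\<Phi> (?B Y)) = fmult (e (?B Y)) \<xi> - ?B Y"
    by (rule \<Phi>_contact(1)) (simp add: Y)
  ultimately have "?B Y = 0" by (simp add: neg_eq_iff_add_eq_0)
  then show ?thesis by (simp add: eq_neg_iff_add_eq_0 add.commute)
qed

lemma d\<Phi>_\<xi>_0: "Y \<in> VF \<Longrightarrow> d\<Phi> \<xi> Y = 0"
  by (simp add: d\<Phi>_\<xi> S_\<Phi>)

text \<open>[\<xi>, \<phi> X] - \<phi> [\<xi>, X] is the derivative of \<phi> along \<xi>, which is
  zero, plus \<phi> S X - S \<phi> X, and S anticommutes with \<phi>.\<close>

lemma h_tensor_eq: "X \<in> VF \<Longrightarrow> h_tensor \<phi> \<xi> X = \<Phi> (S X)"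
  using d\<Phi>_\<xi>_0[of X]
  by (simp add: h_tensor_def lie_deriv11_def torsion S_\<Phi> d\<Phi>_def scaleR_2[symmetric])

text \<open>Let T be the sum of the g(S \<phi> E_i, \<phi> E_i). Inserting the basis once more and
  exchanging the two summations gives the sum of the g(\<phi> S E_j, \<phi> E_j). This is -T because
  S anticommutes with \<phi>, and it is the trace of S because \<phi> is isometric on ker
  \<eta>.\<close>

lemma trace_S:
  assumes E: "orthonormal_at A g p E"
  shows "(\<Sum>i<DIM('e). G (S (E i)) (E i) p) = 0"
proof -
  have EV: "i < DIM('e) \<Longrightarrow> E i \<in> VF" for i using E by (simp add: orthonormal_at_def)
  let ?n = "DIM('e)"
  have "(\<Sum>i<?n. G (S (\<Phi> (E i))) (\<Phi> (E i)) p)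
      = (\<Sum>i<?n. \<Sum>j<?n. G (S (\<Phi> (E i))) (E j) p * G (\<Phi> (E i)) (E j) p)"
    by (intro sum.cong refl) (simp add: parseval[OF E] EV)
  also have "\<dots> = (\<Sum>j<?n. \<Sum>i<?n. G (\<Phi> (S (E j))) (E i) p * G (\<Phi> (E j)) (E i) p)"
  proof (subst sum.swap, intro sum.cong refl)
    fix i j assume ij: "j \<in> {..<?n}" "i \<in> {..<?n}"
    then have v: "E i \<in> VF" "E j \<in> VF" using EV by auto
    have "G (S (\<Phi> (E i))) (E j) p = - G (\<Phi> (S (E j))) (E i) p"
      using v by (simp add: S_sym[of "\<Phi> (E i)" "E j"] G_sym[of "\<Phi> (E i)"] \<Phi>_skew[of "S (E j)" "E i"])
    moreover have "G (\<Phi> (E i)) (E j) p = - G (\<Phi> (E j)) (E i) p"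
      using v by (simp add: \<Phi>_skew[of "E i" "E j"] G_sym[of "E i" "\<Phi> (E j)"])
    ultimately show "G (S (\<Phi> (E i))) (E j) p * G (\<Phi> (E i)) (E j) p = G (\<Phi> (S (E j))) (E i) p * G (\<Phi> (E j)) (E i) p"
      by simp
  qed
  also have "\<dots> = (\<Sum>j<?n. G (\<Phi> (S (E j))) (\<Phi> (E j)) p)"
    by (intro sum.cong refl) (simp add: parseval[OF E] EV)
  also have "\<dots> = - (\<Sum>i<?n. G (S (\<Phi> (E i))) (\<Phi> (E i)) p)"
    using EV by (simp add: S_\<Phi> sum_negf)
  finally have "(\<Sum>i<?n. G (\<Phi> (S (E i))) (\<Phi> (E i)) p) = 0"
    using EV by (simp add: S_\<Phi> sum_negf)
  then show ?thesis using EV by (simp add: G_\<Phi>_\<Phi>)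
qed

end

section \<open>Almost cosymplectic \<open>(\<kappa>, \<mu>)\<close>-manifolds with \<open>\<kappa> < 0\<close>\<close>

locale kappa_mu_manifold = almost_cosymplectic_manifold A g D \<phi> \<xi> \<eta>
  for A :: "('a::{t2_space, second_countable_topology}, 'e::euclidean_space) atlas"
    and g :: "'a bilin" and D :: "'a connection"
    and \<phi> :: "'a tensor11" and \<xi> :: "'a vfield" and \<eta> :: "'a form1" +
  fixes \<kappa> \<mu> :: real
  assumes km: "almost_cosymplectic_kappa_mu A \<phi> \<xi> \<eta> g D \<kappa> \<mu>" and \<kappa>: "\<kappa> < 0"
begin

section \<open>The square of S\<close>

lemma R_\<xi>: "X \<in> VF \<Longrightarrow> Y \<in> VF \<Longrightarrow> curvature D X Y \<xi> =
    \<kappa> *\<^sub>R (fmult (e Y) X - fmult (e X) Y) + \<mu> *\<^sub>R (fmult (e Y) (\<Phi> (S X)) - fmult (e X) (\<Phi> (S Y)))"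
  using km by (simp add: almost_cosymplectic_kappa_mu_def h_tensor_eq)

definition dS :: "'a connection" where "dS X Y = D X (S Y) - S (D X Y)"

lemma dS_vf [simp]: "X \<in> VF \<Longrightarrow> Y \<in> VF \<Longrightarrow> dS X Y \<in> VF"
  by (simp add: dS_def)

text \<open>\<open>S\<^sup>2 + \<kappa>(1 - \<eta> \<otimes> \<xi>) = - \<nabla>\<^sub>\<xi> S - \<mu> h\<close>, where the left side commutes with \<open>\<phi>\<close> and the right
  side anticommutes with it.\<close>

lemma S_square:
  assumes X: "X \<in> VF"
  shows "S (S X) = \<kappa> *\<^sub>R (fmult (e X) \<xi> - X)"
proof -
  define P where "P X = S (S X) + \<kappa> *\<^sub>R (X - fmult (e X) \<xi>)" for X
  have P: "P X = - dS \<xi> X - \<mu> *\<^sub>R \<Phi> (S X)" if "X \<in> VF" for X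
  proof -
    have "e \<xi> = (\<lambda>_. 1)" by (simp add: fun_eq_iff)
    \<comment> \<open>R(X, \<xi>) \<xi> is computed twice: here from the (\<kappa>,
      \<mu>)-condition, then from its definition with S \<xi> = 0.\<close>
    then have "curvature D X \<xi> \<xi> = \<kappa> *\<^sub>R (X - fmult (e X) \<xi>) + \<mu> *\<^sub>R \<Phi> (S X)"
      using R_\<xi>[OF that \<xi>_vf] that by (simp add: fmult_const)
    moreover have "curvature D X \<xi> \<xi> = - dS \<xi> X - S (S X)"
      using that by (simp add: curvature_def dS_def torsion)
    ultimately show ?thesis by (simp add: P_def algebra_simps)
  qed
  have e0: "e (\<Phi> X) = (\<lambda>_. 0)" "e (S X) = (\<lambda>_. 0)" using X by (simp_all add: fun_eq_iff)
  have PV: "P X \<in> VF" using X by (simp add: P_def)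
  have D\<Phi>: "D \<xi> (\<Phi> Y) = \<Phi> (D \<xi> Y)" if "Y \<in> VF" for Y
    using d\<Phi>_\<xi>_0[OF that] by (simp add: d\<Phi>_def)
  have "P (\<Phi> X) = - \<Phi> (P X)"
    using X by (simp add: P dS_def S_\<Phi> D\<Phi> algebra_simps)
  moreover have "P (\<Phi> X) = \<Phi> (P X)"
    using X by (simp add: P_def S_\<Phi> e0)
  ultimately have "2 *\<^sub>R \<Phi> (P X) = 0" by (simp add: scaleR_2)
  then have "\<Phi> (\<Phi> (P X)) = 0" by (simp only: scaleR_eq_0_iff) simp
  moreover have "e (P X) = (\<lambda>_. 0)"
    using X by (simp add: P_def fun_eq_iff)
  ultimately have "P X = 0" using \<Phi>_contact(1)[OF PV] by simp
  then show ?thesis by (simp add: P_def algebra_simps add_eq_0_iff)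
qed

section \<open>Sections of ker \<eta>, along which S is parallel\<close>

text \<open>Global sections stand in for the leaves: all leafwise geometry is done inside the
  algebra of vector fields of the manifold.\<close>

definition H :: "'a vfield set" where "H = {X \<in> VF. e X = (\<lambda>_. 0)}"

lemma H_vf [simp]: "X \<in> H \<Longrightarrow> X \<in> VF" and H_e [simp]: "X \<in> H \<Longrightarrow> e X = (\<lambda>_. 0)"
  by (simp_all add: H_def)

lemma HI: "X \<in> VF \<Longrightarrow> (\<And>p. e X p = 0) \<Longrightarrow> X \<in> H"
  by (simp add: H_def fun_eq_iff del: H_e H_vf)

lemma H_closed [simp]:
  "X \<in> H \<Longrightarrow> Y \<in> H \<Longrightarrow> X + Y \<in> H" "X \<in> H \<Longrightarrow> Y \<in> H \<Longrightarrow> X - Y \<in> H"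
  "X \<in> H \<Longrightarrow> - X \<in> H" "X \<in> H \<Longrightarrow> c *\<^sub>R X \<in> H" "0 \<in> H"
  "X \<in> VF \<Longrightarrow> \<Phi> X \<in> H" "X \<in> VF \<Longrightarrow> S X \<in> H"
  by (rule HI; simp)+

lemma H_eqI:
  assumes X: "X \<in> H" and Y: "Y \<in> H" and eq: "\<And>Z p. Z \<in> H \<Longrightarrow> G X Z p = G Y Z p"
  shows "X = Y"
proof -
  have "G (X - Y) (X - Y) p = 0" for p
    using eq[of "X - Y" p] X Y G_left'(2)[of X Y "X - Y" p] by (simp del: G_left' G_right)
  then have "X - Y = 0" by (rule field_eq_0I[rotated]) (simp add: X Y)
  then show ?thesis by simp
qed

lemma S_square_H [simp]: "X \<in> H \<Longrightarrow> S (S X) = - \<kappa> *\<^sub>R X"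
  by (simp add: S_square)

lemma dS_sym:
  assumes v: "X \<in> VF" "Y \<in> VF" "Z \<in> VF"
  shows "G (dS X Y) Z p = G (dS X Z) Y p"
proof -
  have "G (S Y) Z = G (S Z) Y"
    using v by (simp add: fun_eq_iff S_sym[of Y] G_sym[of Y])
  then have "deriv_along X (G (S Y) Z) p = deriv_along X (G (S Z) Y) p" by simp
  then show ?thesis
    using v by (simp add: compat dS_def S_sym[of "D X _"] G_sym[of "D X _" "S _"])
qed

text \<open>For fields in \<open>H\<close> the (\<kappa>, \<mu>)-condition gives R(X, Y) \<xi> = 0,
  and R(X, Y) \<xi> is the difference of the two sides.\<close>

lemma dS_codazzi:
  assumes v: "X \<in> H" "Y \<in> H"
  shows "dS X Y = dS Y X"
proof -
  have "curvature D X Y \<xi> = 0" using v by (simp add: R_\<xi>)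
  then show ?thesis using v by (simp add: curvature_def dS_def torsion algebra_simps)
qed

text \<open>Differentiating S^2 = \<kappa> (\<eta> \<otimes> \<xi> - I) leaves on \<open>Y\<close> a
  multiple of \<xi>, which is orthogonal to \<open>Z\<close>.\<close>

lemma dS_S:
  assumes v: "X \<in> VF" "Y \<in> H" "Z \<in> H"
  shows "G (dS X (S Y)) Z p = - G (dS X Y) (S Z) p"
proof -
  have "dS X (S Y) + S (dS X Y) = - \<kappa> *\<^sub>R fmult (e (D X Y)) \<xi>"
    using v by (simp add: dS_def S_square algebra_simps)
  then have "G (dS X (S Y) + S (dS X Y)) Z p = 0" using v by simp
  then show ?thesis using v by (simp add: S_sym)
qed

text \<open>On \<open>H\<close> the form g((\<nabla>_X S) Y, Z) is totally symmetric, and moving S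
  from one slot to another changes its sign. A tour of the three slots takes an odd number of moves,
  so the form vanishes once S stands in a slot; and S is invertible on \<open>H\<close>.\<close>

lemma dS_H:
  assumes v: "X \<in> H" "Y \<in> H" "Z \<in> H"
  shows "G (dS X Y) Z p = 0"
proof -
  have *: "G (dS X (S Y)) Z p = 0" if v: "X \<in> H" "Y \<in> H" "Z \<in> H" for X Y Z
  proof -
    have "G (dS X (S Y)) Z p = - G (dS X (S Z)) Y p"
      using v dS_S[of X Y Z p] dS_sym[of X Y "S Z" p] by simp
    also have "\<dots> = - G (dS Y (S Z)) X p"
      using v dS_codazzi[of X "S Z"] dS_codazzi[of Y "S Z"] dS_sym[of "S Z" X Y p] by simp
    also have "\<dots> = G (dS Y Z) (S X) p" using v dS_S[of Y Z X p] by simp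
    finally have 1: "G (dS X (S Y)) Z p = G (dS Y Z) (S X) p" .
    have "G (dS X (S Y)) Z p = G (dS Z (S Y)) X p"
      using v dS_codazzi[of X "S Y"] dS_codazzi[of Z "S Y"] dS_sym[of "S Y" X Z p] by simp
    also have "\<dots> = - G (dS Y Z) (S X) p"
      using v dS_S[of Z Y X p] dS_codazzi[of Y Z] by simp
    finally show ?thesis using 1 by simp
  qed
  \<comment> \<open>With \<open>S Y\<close> in place of \<open>Y\<close>, the argument
    \<open>S (S Y)\<close> is the non-zero multiple \<open>- \<kappa>\<close> of
    \<open>Y\<close>.\<close>
  have "G (dS X (S (S Y))) Z p = 0" using *[of X "S Y" Z] v by (simp del: S_square_H)
  then have "\<kappa> * G (dS X Y) Z p = 0" using v by (auto simp: dS_def)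
  then show ?thesis using \<kappa> by simp
qed

section \<open>Eigenfields of S\<close>

definition a :: real where "a = sqrt (- \<kappa>)"

lemma a: "a > 0" "a * a = - \<kappa>"
  using \<kappa> by (simp_all add: a_def)

definition Hs :: "real \<Rightarrow> 'a vfield set" where "Hs s = {X \<in> H. S X = s *\<^sub>R X}"

lemma Hs_\<Phi>: "X \<in> Hs s \<Longrightarrow> \<Phi> X \<in> Hs (- s)"
  by (simp add: Hs_def S_\<Phi>)

lemma Hs_diff: "X \<in> Hs s \<Longrightarrow> Y \<in> Hs s \<Longrightarrow> X - Y \<in> Hs s"
  by (simp add: Hs_def scaleR_diff_right)

lemma Hs_H [simp]: "X \<in> Hs s \<Longrightarrow> X \<in> H" and Hs_S: "X \<in> Hs s \<Longrightarrow> S X = s *\<^sub>R X"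
  by (simp_all add: Hs_def)

text \<open>The spectral projections sending X to half of X + S X / s have constant coefficients, so
  they split a global field into two global eigenfields. Multilinear identities on \<open>H\<close>
  may thus be checked on eigenfields.\<close>

lemma H_induct [consumes 1, case_names eigen add]:
  assumes X: "X \<in> H" and eig: "\<And>s X. s = a \<or> s = - a \<Longrightarrow> X \<in> Hs s \<Longrightarrow> P X"
    and add: "\<And>X Y. X \<in> H \<Longrightarrow> Y \<in> H \<Longrightarrow> P X \<Longrightarrow> P Y \<Longrightarrow> P (X + Y)"
  shows "P X"
proof -
  have *: "(1/2) *\<^sub>R (X + (1 / s) *\<^sub>R S X) \<in> Hs s" if s: "s = a \<or> s = - a" for s
  proof -
    have s0: "s \<noteq> 0" "s * s = - \<kappa>" using a s by auto
    have "S (S X) = (s * s) *\<^sub>R X" unfolding s0(2) using X by (rule S_square_H)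
    then have "S ((1/2) *\<^sub>R (X + (1 / s) *\<^sub>R S X)) = (1/2) *\<^sub>R (S X + s *\<^sub>R X)"
      using X s0(1) by (simp del: S_square_H)
    also have "\<dots> = s *\<^sub>R ((1/2) *\<^sub>R (X + (1 / s) *\<^sub>R S X))"
      using s0(1) by (simp add: scaleR_add_right)
    finally show ?thesis
      unfolding Hs_def using X by simp
  qed
  let ?Y = "(1/2) *\<^sub>R (X + (1 / a) *\<^sub>R S X)" and ?Z = "(1/2) *\<^sub>R (X + (1 / - a) *\<^sub>R S X)"
  have "P (?Y + ?Z)"
    using *[of a] *[of "- a"] by (intro add eig[of a ?Y] eig[of "- a" ?Z]) simp_all
  moreover have "?Y + ?Z = X"
    by (simp add: algebra_simps scaleR_left_distrib[symmetric])
  ultimately show ?thesis by simp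
qed

section \<open>\<phi> is parallel on ker \<eta>\<close>

lemma d\<Phi>_lin:
  "X \<in> VF \<Longrightarrow> Y \<in> VF \<Longrightarrow> d\<Phi> X (s *\<^sub>R Y) = s *\<^sub>R d\<Phi> X Y"
  "X \<in> VF \<Longrightarrow> Y \<in> VF \<Longrightarrow> Z \<in> VF \<Longrightarrow> d\<Phi> X (Y + Z) = d\<Phi> X Y + d\<Phi> X Z"
  "X \<in> VF \<Longrightarrow> Y \<in> VF \<Longrightarrow> Z \<in> VF \<Longrightarrow> d\<Phi> (X + Y) Z = d\<Phi> X Z + d\<Phi> Y Z"
  by (simp_all add: d\<Phi>_def scaleR_diff_right)

text \<open>Differentiate S \<phi> + \<phi> S = 0; the terms with the derivative of S vanish on
  \<open>H\<close>.\<close>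

lemma d\<Phi>_S:
  assumes v: "X \<in> H" "Y \<in> H" "Z \<in> H"
  shows "G (d\<Phi> X (S Y)) Z p = - G (d\<Phi> X Y) (S Z) p"
proof -
  have "d\<Phi> X (S Y) + S (d\<Phi> X Y) + \<Phi> (dS X Y) + dS X (\<Phi> Y) = 0"
    using v by (simp add: d\<Phi>_def dS_def S_\<Phi>)
  then have "G (d\<Phi> X (S Y) + S (d\<Phi> X Y) + \<Phi> (dS X Y) + dS X (\<Phi> Y)) Z p = 0" using v by simp
  then show ?thesis
    using v by (simp add: S_sym[of "d\<Phi> X Y"] \<Phi>_skew[of "dS X Y"] dS_H)
qed

lemma d\<Phi>_\<Phi>:
  assumes v: "X \<in> VF" "Y \<in> H" "Z \<in> H"
  shows "G (d\<Phi> X (\<Phi> Y)) Z p = G (d\<Phi> X Y) (\<Phi> Z) p"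
proof -
  have "G (d\<Phi> X (\<Phi> Y) + \<Phi> (d\<Phi> X Y)) Z p = 0"
    unfolding d\<Phi>_square[OF v(1) H_vf[OF v(2)]] using v by simp
  then show ?thesis using v by (simp add: \<Phi>_skew[of "d\<Phi> X Y"])
qed

lemma d\<Phi>_H:
  assumes v: "X \<in> H" "Y \<in> H" "Z \<in> H"
  shows "G (d\<Phi> X Y) Z p = 0"
proof -
  \<comment> \<open>Moving S across the form changes the sign, so equal eigenvalues of
    \<open>Y\<close> and \<open>Z\<close> force 0.\<close>
  have same: "G (d\<Phi> X Y) Z p = 0" if "s \<noteq> 0" "X \<in> H" "Y \<in> Hs s" "Z \<in> Hs s" for s X Y Z
  proof -
    have "s * G (d\<Phi> X Y) Z p = - (s * G (d\<Phi> X Y) Z p)"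
      using d\<Phi>_S[of X Y Z p] that by (simp add: Hs_S d\<Phi>_lin)
    then show ?thesis using that by simp
  qed
  \<comment> \<open>One term of the cyclic identity falls under \<open>same\<close>; skewness turns
    the other two into this symmetry.\<close>
  have sym: "G (d\<Phi> X Y) Z p = G (d\<Phi> Y X) Z p"
    if "s \<noteq> 0" "X \<in> Hs s" "Y \<in> Hs s" "Z \<in> Hs (- s)" for s X Y Z
  proof -
    have "G (d\<Phi> X Y) Z p + G (d\<Phi> Y Z) X p + G (d\<Phi> Z X) Y p = 0"
      using that d\<Phi>_cyclic[of X Y Z p] by simp
    moreover have "G (d\<Phi> Z X) Y p = 0" using same that by simp
    moreover have "G (d\<Phi> Y Z) X p = - G (d\<Phi> Y X) Z p" using that d\<Phi>_skew[of Y Z X p] by simp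
    ultimately show ?thesis by simp
  qed
  \<comment> \<open>g((\<nabla>_X \<phi>) Y, \<phi> W) is symmetric in X, Y and skew in Y, W; a
    trilinear form with both properties is zero.\<close>
  have c: "G (d\<Phi> X Y) (\<Phi> W) p = 0"
    if s: "s \<noteq> 0" and m: "X \<in> Hs s" "Y \<in> Hs s" "W \<in> Hs s" for s X Y W
  proof -
    have sy: "G (d\<Phi> X Y) (\<Phi> W) p = G (d\<Phi> Y X) (\<Phi> W) p"
      if "X \<in> Hs s" "Y \<in> Hs s" "W \<in> Hs s" for X Y W
      using sym[OF s that(1,2) Hs_\<Phi>[OF that(3)]] .
    have sk: "G (d\<Phi> X Y) (\<Phi> W) p = - G (d\<Phi> X W) (\<Phi> Y) p"
      if "X \<in> Hs s" "Y \<in> Hs s" "W \<in> Hs s" for X Y W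
      using that d\<Phi>_\<Phi>[of X Y W p] d\<Phi>_skew[of X "\<Phi> Y" W p] by simp
    show ?thesis
      using sy[OF m] sk[OF m(2,1,3)] sy[OF m(2,3,1)] sk[OF m(3,2,1)] sy[OF m(3,1,2)] sk[OF m(1,3,2)]
      by linarith
  qed
  have diff: "G (d\<Phi> X Y) Z p = 0" if "s \<noteq> 0" "X \<in> Hs s" "Y \<in> Hs s" "Z \<in> Hs (- s)" for s X Y Z
  proof -
    have "\<Phi> Z \<in> Hs s" using Hs_\<Phi>[OF that(4)] by simp
    then show ?thesis using c[OF that(1-3), of "\<Phi> Z"] that by simp
  qed
  have diff': "G (d\<Phi> X Y) Z p = 0" if "s \<noteq> 0" "X \<in> Hs s" "Y \<in> Hs (- s)" "Z \<in> Hs s" for s X Y Z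
    using diff[OF that(1,2,4,3)] d\<Phi>_skew[of X Y Z p] that by simp
  \<comment> \<open>Among three eigenvalues from a and -a two agree, which sorts the triples into
    the cases above.\<close>
  have pure: "G (d\<Phi> X Y) Z p = 0"
    if h: "s = a \<or> s = - a" "t = a \<or> t = - a" "u = a \<or> u = - a" "X \<in> Hs s" "Y \<in> Hs t" "Z \<in> Hs u"
    for s t u X Y Z
  proof -
    have nz: "s \<noteq> 0" "t \<noteq> 0" using h(1,2) a by auto
    consider "t = u" | "s = t" "u = - s" | "s = u" "t = - s" using h(1-3) by auto
    then show ?thesis
    proof cases
      case 1
      then show ?thesis using same[OF nz(2) Hs_H[OF h(4)] h(5)] h(6) by simp
    next
      case 2
      then show ?thesis using diff[OF nz(1) h(4)] h(5,6) by simp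
    next
      case 3
      then show ?thesis using diff'[OF nz(1) h(4)] h(5,6) by simp
    qed
  qed
  have 1: "G (d\<Phi> X Y) Z p = 0"
    if h: "s = a \<or> s = - a" "t = a \<or> t = - a" "X \<in> Hs s" "Y \<in> Hs t" "Z \<in> H" for s t X Y Z
    using h(5)
  proof (induction rule: H_induct)
    case (eigen u Z)
    show ?case by (rule pure[OF h(1,2) eigen(1) h(3,4) eigen(2)])
  next
    case (add U V)
    then show "G (d\<Phi> X Y) (U + V) p = 0" using H_vf[OF Hs_H[OF h(3)]] H_vf[OF Hs_H[OF h(4)]] by simp
  qed
  have 2: "G (d\<Phi> X Y) Z p = 0" if h: "s = a \<or> s = - a" "X \<in> Hs s" "Y \<in> H" "Z \<in> H" for s X Y Z
    using h(3)
  proof (induction rule: H_induct)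
    case (eigen t Y)
    show ?case by (rule 1[OF h(1) eigen(1) h(2) eigen(2) h(4)])
  next
    case (add U V)
    then show "G (d\<Phi> X (U + V)) Z p = 0" using H_vf[OF Hs_H[OF h(2)]] H_vf[OF h(4)] by (simp add: d\<Phi>_lin)
  qed
  show ?thesis
    using v(1)
  proof (induction rule: H_induct)
    case (eigen s X)
    show ?case by (rule 2[OF eigen v(2,3)])
  next
    case (add U V)
    then show "G (d\<Phi> (U + V) Y) Z p = 0" using H_vf[OF v(2)] H_vf[OF v(3)] by (simp add: d\<Phi>_lin)
  qed
qed

text \<open>The connection induced on the leaves of \<open>ker \<eta>\<close>. It makes \<open>\<phi>\<close> and \<open>S\<close> parallel, which
  forces it to be flat.\<close>

definition N :: "'a connection" where "N X Y = D X Y - fmult (e (D X Y)) \<xi>"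

lemma N_H [simp]: "X \<in> VF \<Longrightarrow> Y \<in> VF \<Longrightarrow> N X Y \<in> H"
  by (rule HI) (simp_all add: N_def)

lemma G_N [simp]: "X \<in> VF \<Longrightarrow> Y \<in> VF \<Longrightarrow> Z \<in> H \<Longrightarrow> G (N X Y) Z p = G (D X Y) Z p"
  by (simp add: N_def)

lemma N_lin [simp]:
  assumes "X \<in> VF" "Z \<in> VF"
  shows "Y \<in> VF \<Longrightarrow> N (X + Y) Z = N X Z + N Y Z" "Y \<in> VF \<Longrightarrow> N (X - Y) Z = N X Z - N Y Z"
    "N (- X) Z = - N X Z"
    "Y \<in> VF \<Longrightarrow> N X (Y + Z) = N X Y + N X Z" "Y \<in> VF \<Longrightarrow> N X (Y - Z) = N X Y - N X Z"
    "N X (- Z) = - N X Z" "N X (c *\<^sub>R Z) = c *\<^sub>R N X Z"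
  using assms by (auto intro!: H_eqI)

lemma N_\<Phi>: "X \<in> H \<Longrightarrow> Y \<in> H \<Longrightarrow> N X (\<Phi> Y) = \<Phi> (N X Y)"
proof (rule H_eqI)
  fix Z p assume v: "X \<in> H" "Y \<in> H" "Z \<in> H"
  show "G (N X (\<Phi> Y)) Z p = G (\<Phi> (N X Y)) Z p"
    using d\<Phi>_H[OF v, of p] v by (simp add: d\<Phi>_def \<Phi>_skew)
qed simp_all

lemma N_S: "X \<in> H \<Longrightarrow> Y \<in> H \<Longrightarrow> N X (S Y) = S (N X Y)"
proof (rule H_eqI)
  fix Z p assume v: "X \<in> H" "Y \<in> H" "Z \<in> H"
  show "G (N X (S Y)) Z p = G (S (N X Y)) Z p"
    using dS_H[OF v, of p] v by (simp add: dS_def S_sym[of "N X Y"] S_sym[of "D X Y"])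
qed simp_all

lemma N_compat: "X \<in> H \<Longrightarrow> Y \<in> H \<Longrightarrow> Z \<in> H \<Longrightarrow>
    deriv_along X (G Y Z) p = G (N X Y) Z p + G Y (N X Z) p"
  by (simp add: compat G_sym[of Y])

text \<open>The second fundamental form of the leaves, found by differentiating \<eta>(Y) =
  0.\<close>

lemma e_D: "X \<in> VF \<Longrightarrow> Y \<in> H \<Longrightarrow> e (D X Y) p = - G (S X) Y p"
  using deriv_e[of X Y p] by (simp add: G_sym[of Y])

text \<open>Integrability of ker \<eta>: the normal part of the bracket is the skew part of the
  second fundamental form, which is symmetric.\<close>

lemma bracket_H [simp]: "X \<in> H \<Longrightarrow> Y \<in> H \<Longrightarrow> lie_bracket X Y \<in> H"
  by (rule HI) (simp_all add: torsion e_D S_sym G_sym[of X])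

lemma N_torsion: "X \<in> H \<Longrightarrow> Y \<in> H \<Longrightarrow> lie_bracket X Y = N X Y - N Y X"
  by (rule H_eqI, simp, simp) (simp add: torsion)

section \<open>The curvature of the leaves\<close>

lemma R_N_H [simp]: "X \<in> H \<Longrightarrow> Y \<in> H \<Longrightarrow> Z \<in> H \<Longrightarrow> curvature N X Y Z \<in> H"
  by (simp add: curvature_def)

lemma R_N_skew: "X \<in> H \<Longrightarrow> Y \<in> H \<Longrightarrow> Z \<in> H \<Longrightarrow> W \<in> H \<Longrightarrow>
    G (curvature N X Y Z) W p = - G (curvature N X Y W) Z p"
  by (rule curvature_skew[of H H]) (auto simp: N_compat)

lemma R_N_antisym: "X \<in> H \<Longrightarrow> Y \<in> H \<Longrightarrow> Z \<in> H \<Longrightarrow> curvature N X Y Z = - curvature N Y X Z"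
  by (simp add: curvature_def N_torsion)

lemma R_N_lin:
  "X \<in> H \<Longrightarrow> X' \<in> H \<Longrightarrow> Y \<in> H \<Longrightarrow> Z \<in> H \<Longrightarrow>
    curvature N (X + X') Y Z = curvature N X Y Z + curvature N X' Y Z"
  "X \<in> H \<Longrightarrow> Y \<in> H \<Longrightarrow> Y' \<in> H \<Longrightarrow> Z \<in> H \<Longrightarrow>
    curvature N X (Y + Y') Z = curvature N X Y Z + curvature N X Y' Z"
  "X \<in> H \<Longrightarrow> Y \<in> H \<Longrightarrow> Z \<in> H \<Longrightarrow> Z' \<in> H \<Longrightarrow>
    curvature N X Y (Z + Z') = curvature N X Y Z + curvature N X Y Z'"
  by (simp_all add: curvature_def N_torsion)

text \<open>The Jacobi identity, rewritten by the vanishing torsion of \<open>N\<close> on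
  \<open>H\<close>.\<close>

lemma R_N_bianchi:
  assumes v: "X \<in> H" "Y \<in> H" "Z \<in> H"
  shows "curvature N X Y Z + curvature N Y Z X + curvature N Z X Y = 0"
  using lie_bracket_jacobi[of X Y Z] v by (simp add: curvature_def N_torsion algebra_simps)

lemma R_N_\<Phi>: "X \<in> H \<Longrightarrow> Y \<in> H \<Longrightarrow> Z \<in> H \<Longrightarrow> curvature N X Y (\<Phi> Z) = \<Phi> (curvature N X Y Z)"
  by (simp add: curvature_def N_\<Phi>)

lemma N_Hs:
  assumes X: "X \<in> H" and Z: "Z \<in> Hs s"
  shows "N X Z \<in> Hs s"
proof -
  have ZH: "Z \<in> H" using Z by (rule Hs_H)
  have "S (N X Z) = N X (S Z)" using N_S[OF X ZH] by (rule sym)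
  also have "\<dots> = s *\<^sub>R N X Z" unfolding Hs_S[OF Z] by (rule N_lin(7)) (use X ZH in simp_all)
  finally show ?thesis unfolding Hs_def using X ZH by simp
qed

lemma R_N_Hs: "X \<in> H \<Longrightarrow> Y \<in> H \<Longrightarrow> Z \<in> Hs s \<Longrightarrow> curvature N X Y Z \<in> Hs s"
  unfolding curvature_def by (intro Hs_diff N_Hs bracket_H)

lemma Hs_inter: "s \<noteq> 0 \<Longrightarrow> X \<in> Hs s \<Longrightarrow> X \<in> Hs (- s) \<Longrightarrow> X = 0"
proof -
  assume s: "s \<noteq> 0" and "X \<in> Hs s" "X \<in> Hs (- s)"
  then have "s *\<^sub>R X = (- s) *\<^sub>R X" by (metis Hs_S)
  then have "(2 * s) *\<^sub>R X = 0" by (simp add: scaleR_left_distrib[symmetric] eq_neg_iff_add_eq_0)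
  then show ?thesis using s by simp
qed

lemma Hs_uminus: "X \<in> Hs s \<Longrightarrow> - X \<in> Hs s"
  unfolding Hs_def by simp

lemma R_N_eq_0:
  assumes v: "X \<in> H" "Y \<in> H" "Z \<in> H"
  shows "curvature N X Y Z = 0"
proof -
  let ?R = "curvature N"
  \<comment> \<open>In the Bianchi identity R(Z, X) Y lies in the eigenspace of -s while the other
    two terms lie in that of s, so both parts vanish.\<close>
  have opp: "?R Z X Y = 0" "?R X Y Z = ?R Z Y X"
    if s: "s \<noteq> 0" and m: "X \<in> Hs s" "Z \<in> Hs s" "Y \<in> Hs (- s)" for s X Y Z
  proof -
    have h: "X \<in> H" "Y \<in> H" "Z \<in> H" using m Hs_H by blast+
    have b: "?R Z X Y = (- ?R X Y Z) - ?R Y Z X"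
      using R_N_bianchi[OF h] by (simp add: algebra_simps eq_neg_iff_add_eq_0)
    have "?R Z X Y \<in> Hs s"
      unfolding b by (intro Hs_diff Hs_uminus R_N_Hs h m)
    moreover have "?R Z X Y \<in> Hs (- s)" by (intro R_N_Hs h m)
    ultimately show z: "?R Z X Y = 0" by (rule Hs_inter[OF s])
    show "?R X Y Z = ?R Z Y X"
      using b z R_N_antisym[OF h(2,3,1)] by simp
  qed
  \<comment> \<open>\<phi> commutes with the curvature and exchanges the eigenspaces, which reduces
    this case to \<open>opp\<close>.\<close>
  have same: "?R X Y Z = 0"
    if s: "s \<noteq> 0" and m: "X \<in> Hs s" "Y \<in> Hs s" "Z \<in> Hs s" for s X Y Z
  proof -
    have h: "X \<in> H" "Y \<in> H" "Z \<in> H" using m Hs_H by blast+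
    have "\<Phi> (?R X Y Z) = 0"
      using opp(1)[OF s m(2,1) Hs_\<Phi>[OF m(3)]] R_N_\<Phi>[OF h] by simp
    then have "\<Phi> (\<Phi> (?R X Y Z)) = 0" by simp
    then show ?thesis using h by simp
  qed
  \<comment> \<open>For fixed Y the form g(R(X, Y) Z, W) is symmetric in X, Z by \<open>opp\<close>
    and skew in Z, W, hence zero. It is evaluated at W = R(X, Y) Z, which stays in the same
    eigenspace.\<close>
  have mixed: "?R X Y Z = 0"
    if s: "s \<noteq> 0" and m: "X \<in> Hs s" "Y \<in> Hs (- s)" "Z \<in> Hs s" for s X Y Z
  proof (rule field_eq_0I)
    fix p
    have h: "X \<in> H" "Y \<in> H" "Z \<in> H" using m Hs_H by blast+
    let ?W = "?R X Y Z"
    have W: "?W \<in> Hs s" by (intro R_N_Hs h m)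
    have wh: "?W \<in> H" using h by simp
    have sy: "G (?R X Y Z) W p = G (?R Z Y X) W p" if "X \<in> Hs s" "Z \<in> Hs s" for X Z W
      using opp(2)[OF s that m(2)] by simp
    have sk: "G (?R X Y Z) W p = - G (?R X Y W) Z p" if "X \<in> H" "Z \<in> H" "W \<in> H" for X Z W
      using R_N_skew that h(2) by blast
    show "G ?W ?W p = 0"
      using sy[OF m(1,3), of ?W] sk[OF h(3,1) wh] sy[OF m(3) W, of X] sk[OF wh h(3,1)]
        sy[OF W m(1), of Z] sk[OF h(1) wh h(3)] by linarith
  next
    show "?R X Y Z \<in> VF" using m Hs_H by simp
  qed
  have pure: "?R X Y Z = 0"
    if h: "s = a \<or> s = - a" "t = a \<or> t = - a" "u = a \<or> u = - a" "X \<in> Hs s" "Y \<in> Hs t" "Z \<in> Hs u"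
    for s t u X Y Z
  proof -
    have nz: "s \<noteq> 0" "t \<noteq> 0" using h(1,2) a by auto
    consider "s = t" "t = u" | "s = t" "u = - s" | "u = s" "t = - s" | "u = t" "s = - t"
      using h(1-3) by auto
    then show ?thesis
    proof cases
      case 1
      then show ?thesis using same[OF nz(1) h(4)] h(5,6) by simp
    next
      case 2
      then show ?thesis using opp(1)[OF nz(1) _ h(4)] h(5,6) by simp
    next
      case 3
      then show ?thesis using mixed[OF nz(1) h(4)] h(5,6) by simp
    next
      case 4
      then have "?R Y X Z = 0" using mixed[OF nz(2) h(5)] h(4,6) by simp
      then show ?thesis using R_N_antisym[OF h(4-6)[THEN Hs_H]] by simp
    qed
  qed
  have 1: "?R X Y Z = 0"
    if h: "s = a \<or> s = - a" "t = a \<or> t = - a" "X \<in> Hs s" "Y \<in> Hs t" "Z \<in> H" for s t X Y Z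
    using h(5)
  proof (induction rule: H_induct)
    case (eigen u Z)
    show ?case by (rule pure[OF h(1,2) eigen(1) h(3,4) eigen(2)])
  next
    case (add U V)
    have "?R X Y U = 0" "?R X Y V = 0" by (rule add)+
    then show "?R X Y (U + V) = 0" by (simp add: R_N_lin(3)[OF Hs_H[OF h(3)] Hs_H[OF h(4)] add(1,2)])
  qed
  have 2: "?R X Y Z = 0" if h: "s = a \<or> s = - a" "X \<in> Hs s" "Y \<in> H" "Z \<in> H" for s X Y Z
    using h(3)
  proof (induction rule: H_induct)
    case (eigen t Y)
    show ?case by (rule 1[OF h(1) eigen(1) h(2) eigen(2) h(4)])
  next
    case (add U V)
    have "?R X U Z = 0" "?R X V Z = 0" by (rule add)+
    then show "?R X (U + V) Z = 0" by (simp add: R_N_lin(2)[OF Hs_H[OF h(2)] add(1,2) h(4)])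
  qed
  show ?thesis
    using v(1)
  proof (induction rule: H_induct)
    case (eigen s X)
    show ?case by (rule 2[OF eigen v(2,3)])
  next
    case (add U V)
    have "?R U Y Z = 0" "?R V Y Z = 0" by (rule add)+
    then show "?R (U + V) Y Z = 0" by (simp add: R_N_lin(1)[OF add(1,2) v(2,3)])
  qed
qed

section \<open>The Gauss equation and the Ricci tensor\<close>

text \<open>The leaves being flat, only the terms quadratic in the second fundamental form are
  left.\<close>

lemma gauss:
  assumes v: "X \<in> H" "Y \<in> H" "Z \<in> H" "W \<in> H"
  shows "G (curvature D X Y Z) W p = G (S X) Z p * G (S Y) W p - G (S Y) Z p * G (S X) W p"
proof -
  \<comment> \<open>The normal part of \<nabla>_Y Z is - g(S Y, Z) \<xi>; differentiating its factor
    \<xi> produces the extra term with S X.\<close>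
  have *: "G (N X (N Y Z)) W p = G (D X (D Y Z)) W p + G (S Y) Z p * G (S X) W p"
    if "X \<in> H" "Y \<in> H" for X Y
    using that v by (simp add: N_def[of Y Z] D_fmult(2) e_D)
  have "G (curvature N X Y Z) W p = 0" using v by (simp add: R_N_eq_0)
  then show ?thesis
    using v *[OF v(1,2)] *[OF v(2,1)] by (simp add: curvature_def)
qed

lemma ricci_H:
  assumes Y: "Y \<in> H" and Z: "Z \<in> H"
  shows "ricci A g D Y Z p = \<mu> * G (\<Phi> (S Y)) Z p"
proof -
  obtain E where E: "orthonormal_at A g p E"
    and ric: "\<And>Y Z. ricci A g D Y Z p = (\<Sum>i<DIM('e). G (curvature D (E i) Y Z) (E i) p)"
    using ricci_eq_sum by blast
  have EV: "i < DIM('e) \<Longrightarrow> E i \<in> VF" for i using E by (simp add: orthonormal_at_def)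
  let ?W = "curvature D \<xi> Y Z"
  \<comment> \<open>The chosen basis need not contain \<xi>. Each member is therefore split into its
    part in ker \<eta> and its multiple of \<xi>, with the result written so that Parseval's
    identity can sum it.\<close>
  have "G (curvature D U Y Z) U p = G (S Z) U p * G (S Y) U p - G (S Y) Z p * G (S U) U p + G \<xi> U p * G ?W U p"
    if U: "U \<in> VF" for U
  proof -
    define F where "F = U - fmult (e U) \<xi>"
    have F: "F \<in> H" using U by (auto simp: F_def intro: HI)
    have UF: "U = F + fmult (e U) \<xi>" by (simp add: F_def)
    have SF: "S F = S U" using U by (simp add: F_def)
    have "curvature D U Y Z = curvature D F Y Z + fmult (e U) ?W"
      using U F Y Z curvature_left(1)[of F Y Z "fmult (e U) \<xi>"] curvature_left(2)[of \<xi> Y Z "e U"] UF by simp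
    \<comment> \<open>No mixed term arises, since R(F, Y) \<xi> = 0 for fields in
      \<open>H\<close>.\<close>
    moreover have "G (curvature D F Y Z) \<xi> p = 0"
      using curvature_skew_D[of F Y Z \<xi> p] F Y Z by (simp add: R_\<xi>)
    moreover have "G V U p = G V F p + e U p * G V \<xi> p" if "V \<in> VF" for V
      using U F that by (simp add: F_def)
    moreover have "G (S V) F p = G (S V) U p" if "V \<in> VF" for V
      using that U by (simp add: F_def)
    ultimately show ?thesis
      using U F Y Z gauss[OF F Y Z F, of p] by (simp add: SF S_sym[of U Z] G_sym[of U "S Z"] distrib_left)
  qed
  then have "ricci A g D Y Z p = (\<Sum>i<DIM('e). G (S Z) (E i) p * G (S Y) (E i) p
      - G (S Y) Z p * G (S (E i)) (E i) p + G \<xi> (E i) p * G ?W (E i) p)"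
    unfolding ric using EV by (intro sum.cong refl) simp
  also have "\<dots> = G (S Z) (S Y) p - G (S Y) Z p * 0 + G \<xi> ?W p"
    using Y Z
    by (simp only: sum.distrib sum_subtractf sum_distrib_left[symmetric] trace_S[OF E]
        parseval[OF E] \<xi>_vf H_vf D_vf curvature_vf)
  \<comment> \<open>This is cancelled by the \<kappa>-part of the contribution of \<xi>, so that
    only the \<mu>-part remains.\<close>
  also have "G (S Z) (S Y) p = - \<kappa> * G Y Z p"
    using Y Z by (simp add: S_sym[of Z] G_sym[of Z])
  also have "G \<xi> ?W p = \<kappa> * G Y Z p + \<mu> * G (\<Phi> (S Y)) Z p"
  proof -
    have e1: "e \<xi> = (\<lambda>_. 1)" by (simp add: fun_eq_iff)
    have "curvature D Y \<xi> \<xi> = \<kappa> *\<^sub>R Y + \<mu> *\<^sub>R \<Phi> (S Y)"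
      using Y by (simp add: R_\<xi> e1 fmult_const)
    moreover have "G ?W \<xi> p = - G (curvature D \<xi> Y \<xi>) Z p"
      using curvature_skew_D[of \<xi> Y Z \<xi> p] Y Z by simp
    moreover have "curvature D \<xi> Y \<xi> = - curvature D Y \<xi> \<xi>"
      using curvature_antisym[of \<xi> Y \<xi>] Y by simp
    ultimately show ?thesis using Y Z by (simp add: G_sym[of \<xi>])
  qed
  finally show ?thesis by simp
qed

text \<open>R(E, \<xi>) \<xi> = \<kappa> (E - \<eta>(E) \<xi>) when \<mu> = 0, and by Parseval the
  squares of the \<eta>(E_i) add up to 1.\<close>

lemma ricci_\<xi>_\<xi>:
  assumes "\<mu> = 0"
  shows "ricci A g D \<xi> \<xi> p = \<kappa> * (real DIM('e) - 1)"
proof -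
  obtain E where E: "orthonormal_at A g p E"
    and ric: "\<And>Y Z. ricci A g D Y Z p = (\<Sum>i<DIM('e). G (curvature D (E i) Y Z) (E i) p)"
    using ricci_eq_sum by blast
  have EV: "i < DIM('e) \<Longrightarrow> E i \<in> VF" and EE: "i < DIM('e) \<Longrightarrow> G (E i) (E i) p = 1" for i
    using E by (simp_all add: orthonormal_at_def app2_def)
  have e1: "e \<xi> = (\<lambda>_. 1)" by (simp add: fun_eq_iff)
  have "ricci A g D \<xi> \<xi> p = (\<Sum>i<DIM('e). \<kappa> * (1 - G \<xi> (E i) p * G \<xi> (E i) p))"
    unfolding ric using EV EE by (intro sum.cong refl) (simp add: R_\<xi> e1 fmult_const assms)
  also have "\<dots> = \<kappa> * (real DIM('e) - G \<xi> \<xi> p)"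
    by (simp only: sum_distrib_left[symmetric] sum_subtractf parseval[OF E \<xi>_vf \<xi>_vf]) simp
  finally show ?thesis by simp
qed

section \<open>Excluding quasi-Einstein structures along \<xi>\<close>

text \<open>The horizontal parts of two members of an orthonormal basis have squared lengths 1 -
  \<eta>(E_i)^2. These sum to at least 2 - 1, so one of the two parts is non-zero.\<close>

lemma horizontal_field:
  assumes "DIM('e) \<ge> 2"
  obtains X where "X \<in> H" "G X X p > 0"
proof -
  obtain E where E: "orthonormal_at A g p E"
    using ricci_eq_sum by blast
  have EV: "i < DIM('e) \<Longrightarrow> E i \<in> VF" and EE: "i < DIM('e) \<Longrightarrow> G (E i) (E i) p = 1" for i
    using E by (simp_all add: orthonormal_at_def app2_def)
  define F where "F i = E i - fmult (e (E i)) \<xi>" for i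
  have F: "F i \<in> H" and FF: "G (F i) (F i) p = 1 - G \<xi> (E i) p * G \<xi> (E i) p" if "i < DIM('e)" for i
    using EV[OF that] EE[OF that] by (auto simp: F_def intro: HI)
  have "(\<Sum>i<2. G \<xi> (E i) p * G \<xi> (E i) p) \<le> (\<Sum>i<DIM('e). G \<xi> (E i) p * G \<xi> (E i) p)"
    using assms by (intro sum_mono2) auto
  also have "\<dots> = 1" by (simp add: parseval[OF E] del: G_\<xi>) simp
  finally have "G (F 0) (F 0) p > 0 \<or> G (F 1) (F 1) p > 0"
    using FF[of 0] FF[of 1] assms by (simp add: numeral_2_eq_2 del: G_\<xi>) linarith
  then show ?thesis using that F[of 0] F[of 1] assms by auto
qed

lemma not_quasi_einstein:
  assumes dim: "DIM('e) \<ge> 2"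
    and qe: "quasi_einstein A g D V m lam" and V: "V = fmult (app1 \<eta> V) \<xi>"
  shows False
proof -
  define f where "f = e V"
  have VV: "V \<in> VF" using qe by (simp add: quasi_einstein_def)
  have f: "smooth_fun A f" using VV by (simp add: f_def)
  have Vf: "V = fmult f \<xi>" using V by (simp add: f_def)
  have q: "ricci A g D X Y p + (1/2) * lie_deriv2 V g X Y p - recip m * (G V X p * G V Y p) = lam * G X Y p"
    if "X \<in> VF" "Y \<in> VF" for X Y p
  proof -
    have "ricci A g D X Y + (1/2) *\<^sub>R lie_deriv2 V g X Y
         - recip m *\<^sub>R (\<lambda>p. app1 (flat g V) X p * app1 (flat g V) Y p) = lam *\<^sub>R app2 g X Y"
      using qe that by (simp add: quasi_einstein_def)
    from fun_cong[OF this, of p] show ?thesis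
      by (simp add: scaleR_fun_def app1_def flat_def app2_def)
  qed
  have eq: "\<mu> * G (\<Phi> (S X)) Y p + f p * G (S X) Y p = lam * G X Y p"
    if X: "X \<in> H" and Y: "Y \<in> H" for X Y p
  proof -
    \<comment> \<open>The \<xi>-part is orthogonal to \<open>H\<close>, so there the Lie derivative
      of g reduces to 2 f g(S X, Y).\<close>
    have D: "D W V = fmult (deriv_along W f) \<xi> + fmult f (S W)" if "W \<in> VF" for W
      unfolding Vf using that f by (simp add: D_fmult(2))
    have "lie_deriv2 V g X Y p = G (D X V) Y p + G X (D Y V) p"
      using X Y VV by (simp add: lie_deriv2_def torsion compat)
    also have "\<dots> = 2 * (f p * G (S X) Y p)"
      using X Y f by (simp add: D S_sym[of X])
    finally have l: "lie_deriv2 V g X Y p = 2 * (f p * G (S X) Y p)" .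
    \<comment> \<open>\<open>V\<close> is a multiple of \<xi>, so its dual form vanishes on
      \<open>H\<close> and the term with 1/m drops out.\<close>
    have "G V X p = 0" using X by (simp add: Vf)
    then show ?thesis using q[of X Y p] X Y l by (simp add: ricci_H)
  qed
  have lam: "lam = 0"
  proof -
    fix p
    obtain X where X: "X \<in> H" "G X X p > 0" using horizontal_field[OF dim] by blast
    \<comment> \<open>Replacing X by \<phi> X reverses the sign of the left side of
      \<open>eq\<close> but preserves g(X, X), as X lies in ker \<eta>.\<close>
    have "\<mu> * G (\<Phi> (S (\<Phi> X))) (\<Phi> X) p + f p * G (S (\<Phi> X)) (\<Phi> X) p
        = - (\<mu> * G (\<Phi> (S X)) X p + f p * G (S X) X p)"
      using X(1) by (simp add: S_\<Phi> G_\<Phi>_\<Phi> \<Phi>_skew[of "S X" X])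
    moreover have "G (\<Phi> X) (\<Phi> X) p = G X X p"
      using X(1) by (simp add: G_\<Phi>_\<Phi>)
    ultimately have "lam * G X X p = - (lam * G X X p)"
      using eq[OF X(1) X(1), of p] eq[of "\<Phi> X" "\<Phi> X" p] X(1) by simp
    then show ?thesis using X(2) by simp
  qed
  have 0: "f p = 0 \<and> \<mu> = 0" for p
  proof -
    obtain X where X: "X \<in> H" "G X X p > 0" using horizontal_field[OF dim] by blast
    have SS: "G (S X) (S X) p > 0"
      using X \<kappa> by (simp add: S_sym[of X] mult_neg_pos)
    have sk: "G (\<Phi> (S X)) (S X) p = 0"
      using \<Phi>_skew[of "S X" "S X" p] G_sym[of "S X" "\<Phi> (S X)" p] X by simp
    \<comment> \<open>With Y = S X the \<mu>-term vanishes because \<phi> is skew. Then f = 0, and Y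
      = \<phi> S X isolates the \<mu>-term.\<close>
    have f0: "f p = 0" using eq[of X "S X" p] X SS sk lam by simp
    have "\<mu> * G (S X) (S X) p = 0"
      using eq[of X "\<Phi> (S X)" p] X lam f0 by (simp add: G_\<Phi>_\<Phi>)
    then show ?thesis using f0 SS by simp
  qed
  then have V0: "V = 0" by (simp add: Vf fmult_def zero_fun_def scaleR_fun_def)
  \<comment> \<open>With \<open>V = 0\<close> and \<open>lam = 0\<close> the equation at (\<xi>,
    \<xi>) reduces to its Ricci term, whose value is \<kappa> times the positive number
    \<open>DIM('e) - 1\<close>.\<close>
  have "ricci A g D \<xi> \<xi> p = 0" for p
    using q[of \<xi> \<xi> p] lam by (simp add: V0 lie_deriv2_def torsion) (simp add: deriv_along_def)
  then show False using ricci_\<xi>_\<xi> 0 \<kappa> dim by simp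
qed

end

theorem theorem3p5:
  fixes A :: "('a::{t2_space, second_countable_topology}, 'e::euclidean_space) atlas"
    and \<phi> :: "'a tensor11" and \<xi> :: "'a vfield" and \<eta> :: "'a form1" and g :: "'a bilin"
    and D :: "'a connection" and \<kappa> \<mu> :: real and n :: nat
  assumes "smooth_manifold A"
    and "DIM('e) = 2 * n + 1" and "n \<ge> 1"
    and "compact (UNIV :: 'a set)"
    and "almost_cosymplectic_kappa_mu A \<phi> \<xi> \<eta> g D \<kappa> \<mu>"
    and "\<kappa> < 0"
  shows "\<not> (\<exists>(V :: 'a vfield) (m :: enat) (lam :: real).
           quasi_einstein A g D V m lam \<and> V = fmult (app1 \<eta> V) \<xi>)"
proof -
  interpret kappa_mu_manifold A g D \<phi> \<xi> \<eta> \<kappa> \<mu>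
    using assms
    by unfold_locales
      (simp_all add: almost_cosymplectic_kappa_mu_def almost_cosymplectic_def almost_contact_metric_def)
  show ?thesis
    using not_quasi_einstein assms(2,3) by auto
qed

end
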